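(* Let $k\ge 1$. For any irreducible representation $\tau$ of $\mathrm{GL}_k(\mathbb{E})$, any character $\chi\colon\mathbb{E}^\times\to\mathbb{C}^\times$ and any non-trivial additive character $\psi\colon\mathbb{F}\to\mathbb{C}^\times$, the following identity holds: $$\mathrm{J}^{\mathrm{dbl}}(\tau,\chi)=\chi(-1)^k\,\bigl(-\tau(\chi^{-1},\psi_{\mathbb{E}})\bigr)^k\,\mathrm{G}(\tau^\vee,\psi_{\mathbb{E}})\,\mathrm{G}(\tau\times\chi,\psi_{\mathbb{E}}),$$ where $\tau^\vee$ is the contragredient of $\tau$.
   Context: $\mathbb{F}$ is a finite field with $q$ elements, $q$ odd; $\mathbb{E}/\mathbb{F}$ is an extension of degree $1$ or $2$; $\psi_{\mathbb{E}}=\psi\circ\mathrm{tr}_{\mathbb{E}/\mathbb{F}}$. Abelian Gauss sum: for a character $\beta$ of $\mathbb{E}^\times$, $\tau(\beta,\psi_{\mathbb{E}})=-q^{-[\mathbb{E}:\mathbb{F}]/2}\sum_{x\in\mathbb{E}^\times}\beta^{-1}(x)\psi_{\mathbb{E}}(x)$. Non-abelian (Kondo) Gauss sums: for an irreducible representation $\tau$ of $\mathrm{GL}_k(\mathbb{E})$ and a character $\chi$ of $\mathbb{E}^\times$, $\mathrm{G}(\tau\times\chi,\psi_{\mathbb{E}})\in\mathbb{C}$ is the scalar such that $$q^{-[\mathbb{E}:\mathbb{F}]k^2/2}\sum_{g\in\mathrm{GL}_k(\mathbb{E})}\tau(g)\chi(\det g)\psi_{\mathbb{E}}(\mathrm{tr}\,g^{-1})=\mathrm{G}(\tau\times\chi,\psi_{\mathbb{E}})\cdot\mathrm{id}_\tau,$$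 and $\mathrm{G}(\tau,\psi_{\mathbb{E}})=\mathrm{G}(\tau\times 1,\psi_{\mathbb{E}})$. Kernel: if $\chi\ne1$, $\Phi_\chi\colon\mathrm{GL}_k(\mathbb{E})\to\mathbb{C}$ is $\Phi_\chi(g)=\chi(\det(I_k+g))$ if $\det(I_k+g)\neq0$ and $0$ otherwise. If $\chi=1$, $\Phi_1$ is defined by $$\Phi_1(g)=q^{-[\mathbb{E}:\mathbb{F}]k^2/2}\,\mathrm{G}(1_{\mathrm{GL}_k},\psi_{\mathbb{E}})\sum_{x\in\mathrm{GL}_k(\mathbb{E})}\psi_{\mathbb{E}}(\mathrm{tr}(x(I_k+g))),$$ where $1_{\mathrm{GL}_k}$ is the trivial representation. Jacobi sum: $\mathrm{J}^{\mathrm{dbl}}(\tau,\chi)\in\mathbb{C}$ is the scalar such that $$q^{-[\mathbb{E}:\mathbb{F}]k^2/2}\sum_{g\in\mathrm{GL}_k(\mathbb{E})}\Phi_\chi(g)\tau(g)=\mathrm{J}^{\mathrm{dbl}}(\tau,\chi)\cdot\mathrm{id}_\tau.$$ *)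

theory Defs
  imports
    Complex_Main
    "HOL-Library.Cardinality"
    "HOL-Library.Function_Algebras"
    "Jordan_Normal_Form.Determinant"
begin

section \<open>Finite field extensions and characters\<close>

text \<open>A field extension is given by an embedding \<open>\<iota>\<close> of \<open>'f\<close> into \<open>'e\<close>, through which \<open>'e\<close> is
  an \<open>'f\<close>-vector space.\<close>

definition ext_scale :: "('f::field \<Rightarrow> 'e::field) \<Rightarrow> 'f \<Rightarrow> 'e \<Rightarrow> 'e" where
  "ext_scale \<iota> a x = \<iota> a * x"

definition ext_degree :: "('f::field \<Rightarrow> 'e::field) \<Rightarrow> nat" where
  "ext_degree \<iota> = vector_space.dim (ext_scale \<iota>) UNIV"

definition ext_basis :: "('f::field \<Rightarrow> 'e::field) \<Rightarrow> 'e set" where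
  "ext_basis \<iota> = (SOME B. \<not> module.dependent (ext_scale \<iota>) B \<and> module.span (ext_scale \<iota>) B = UNIV)"

text \<open>The trace of the \<open>'f\<close>-linear map \<open>y \<mapsto> x * y\<close>: \<open>module.representation s B v b\<close> is the
  \<open>b\<close>-coordinate of \<open>v\<close> in the basis \<open>B\<close>.\<close>

definition ext_trace :: "('f::field \<Rightarrow> 'e::field) \<Rightarrow> 'e \<Rightarrow> 'f" where
  "ext_trace \<iota> x =
     (\<Sum>b\<in>ext_basis \<iota>. module.representation (ext_scale \<iota>) (ext_basis \<iota>) (x * b) b)"

definition add_character :: "('f::field \<Rightarrow> complex) \<Rightarrow> bool" where
  "add_character \<psi> \<longleftrightarrow> (\<forall>x y. \<psi> (x + y) = \<psi> x * \<psi> y) \<and> (\<forall>x. \<psi> x \<noteq> 0)"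

text \<open>A character of the multiplicative group is a function on the whole type, of which only the
  values at nonzero arguments matter; accordingly triviality is tested there only.\<close>

definition mult_character :: "('e::field \<Rightarrow> complex) \<Rightarrow> bool" where
  "mult_character \<chi> \<longleftrightarrow>
     (\<forall>x y. x \<noteq> 0 \<longrightarrow> y \<noteq> 0 \<longrightarrow> \<chi> (x * y) = \<chi> x * \<chi> y) \<and> (\<forall>x. x \<noteq> 0 \<longrightarrow> \<chi> x \<noteq> 0)"

definition trivial_character :: "('e::field \<Rightarrow> complex) \<Rightarrow> bool" where
  "trivial_character \<chi> \<longleftrightarrow> (\<forall>x. x \<noteq> 0 \<longrightarrow> \<chi> x = 1)"

definition ext_character :: "('f::field \<Rightarrow> 'e::field) \<Rightarrow> ('f \<Rightarrow> complex) \<Rightarrow> 'e \<Rightarrow> complex" where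
  "ext_character \<iota> \<psi> x = \<psi> (ext_trace \<iota> x)"

section \<open>Complex representations\<close>

text \<open>The representation space is a subspace of an ambient complex vector space, so that the dual
  space can be taken inside the type of all complex-valued functions. The action is constrained
  only on the carrier of the group and on the representation space.\<close>

record ('g, 'v) rep =
  rep_space :: "'v set"
  rep_scale :: "complex \<Rightarrow> 'v \<Rightarrow> 'v"
  rep_act :: "'g \<Rightarrow> 'v \<Rightarrow> 'v"

definition is_rep :: "('g, 'm) monoid_scheme \<Rightarrow> ('g, 'v::ab_group_add) rep \<Rightarrow> bool" where
  "is_rep G \<pi> \<longleftrightarrow>
     vector_space (rep_scale \<pi>) \<and>
     module.subspace (rep_scale \<pi>) (rep_space \<pi>) \<and>
     (\<exists>B. finite B \<and> rep_space \<pi> \<subseteq> module.span (rep_scale \<pi>) B) \<and>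
     (\<forall>g\<in>carrier G. \<forall>v\<in>rep_space \<pi>. rep_act \<pi> g v \<in> rep_space \<pi>) \<and>
     (\<forall>g\<in>carrier G. \<forall>v\<in>rep_space \<pi>. \<forall>w\<in>rep_space \<pi>.
        rep_act \<pi> g (v + w) = rep_act \<pi> g v + rep_act \<pi> g w) \<and>
     (\<forall>g\<in>carrier G. \<forall>c. \<forall>v\<in>rep_space \<pi>.
        rep_act \<pi> g (rep_scale \<pi> c v) = rep_scale \<pi> c (rep_act \<pi> g v)) \<and>
     (\<forall>v\<in>rep_space \<pi>. rep_act \<pi> \<one>\<^bsub>G\<^esub> v = v) \<and>
     (\<forall>g\<in>carrier G. \<forall>h\<in>carrier G. \<forall>v\<in>rep_space \<pi>.
        rep_act \<pi> (g \<otimes>\<^bsub>G\<^esub> h) v = rep_act \<pi> g (rep_act \<pi> h v))"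

definition irreducible_rep :: "('g, 'm) monoid_scheme \<Rightarrow> ('g, 'v::ab_group_add) rep \<Rightarrow> bool" where
  "irreducible_rep G \<pi> \<longleftrightarrow>
     is_rep G \<pi> \<and> rep_space \<pi> \<noteq> {0} \<and>
     (\<forall>W. module.subspace (rep_scale \<pi>) W \<and> W \<subseteq> rep_space \<pi> \<and>
          (\<forall>g\<in>carrier G. \<forall>w\<in>W. rep_act \<pi> g w \<in> W) \<longrightarrow> W = {0} \<or> W = rep_space \<pi>)"

text \<open>Linear functionals on \<open>rep_space \<pi>\<close> are represented by functions vanishing outside it, so
  that each functional has exactly one representative.\<close>

definition dual_space :: "('g, 'v::ab_group_add) rep \<Rightarrow> ('v \<Rightarrow> complex) set" where
  "dual_space \<pi> =
     {f. (\<forall>v\<in>rep_space \<pi>. \<forall>w\<in>rep_space \<pi>. f (v + w) = f v + f w) \<and>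
         (\<forall>c. \<forall>v\<in>rep_space \<pi>. f (rep_scale \<pi> c v) = c * f v) \<and>
         (\<forall>v. v \<notin> rep_space \<pi> \<longrightarrow> f v = 0)}"

definition contragredient ::
  "('g, 'm) monoid_scheme \<Rightarrow> ('g, 'v::ab_group_add) rep \<Rightarrow> ('g, 'v \<Rightarrow> complex) rep" where
  "contragredient G \<pi> =
     \<lparr>rep_space = dual_space \<pi>,
      rep_scale = (\<lambda>c f v. c * f v),
      rep_act = (\<lambda>g f v. if v \<in> rep_space \<pi> then f (rep_act \<pi> (inv\<^bsub>G\<^esub> g) v) else 0)\<rparr>"

definition trivial_rep :: "('g, complex) rep" where
  "trivial_rep = \<lparr>rep_space = UNIV, rep_scale = (*), rep_act = (\<lambda>g v. v)\<rparr>"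

definition scalar_of :: "('g, 'v::ab_group_add) rep \<Rightarrow> ('v \<Rightarrow> 'v) \<Rightarrow> complex" where
  "scalar_of \<pi> T = (THE c. \<forall>v\<in>rep_space \<pi>. T v = rep_scale \<pi> c v)"

section \<open>Gauss sums and Jacobi sums\<close>

definition GL :: "nat \<Rightarrow> 'a::comm_ring_1 mat monoid" where
  "GL k = units_of (ring_mat TYPE('a) k ())"

definition mat_trace :: "'a::comm_ring_1 mat \<Rightarrow> 'a" where
  "mat_trace A = (\<Sum>i<dim_row A. A $$ (i, i))"

text \<open>\<open>norm_factor \<iota> m\<close> is \<open>q\<close> to the power \<open>-[E:F] m / 2\<close>, where \<open>q\<close> is the cardinality of the
  base field.\<close>

definition norm_factor :: "('f::{field,finite} \<Rightarrow> 'e::{field,finite}) \<Rightarrow> nat \<Rightarrow> complex" where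
  "norm_factor \<iota> m =
     complex_of_real (real CARD('f) powr (- (real (ext_degree \<iota>) * real m / 2)))"

definition abelian_gauss ::
  "('f::{field,finite} \<Rightarrow> 'e::{field,finite}) \<Rightarrow> ('f \<Rightarrow> complex) \<Rightarrow> ('e \<Rightarrow> complex) \<Rightarrow> complex" where
  "abelian_gauss \<iota> \<psi> \<beta> =
     - norm_factor \<iota> 1 * (\<Sum>x\<in>{x. x \<noteq> 0}. inverse (\<beta> x) * ext_character \<iota> \<psi> x)"

definition kondo_gauss ::
  "('f::{field,finite} \<Rightarrow> 'e::{field,finite}) \<Rightarrow> ('f \<Rightarrow> complex) \<Rightarrow> nat \<Rightarrow>
   ('e mat, 'v::ab_group_add) rep \<Rightarrow> ('e \<Rightarrow> complex) \<Rightarrow> complex" where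
  "kondo_gauss \<iota> \<psi> k \<pi> \<chi> =
     scalar_of \<pi> (\<lambda>v. rep_scale \<pi> (norm_factor \<iota> (k\<^sup>2))
       (\<Sum>g\<in>carrier (GL k).
          rep_scale \<pi> (\<chi> (det g) * ext_character \<iota> \<psi> (mat_trace (inv\<^bsub>GL k\<^esub> g))) (rep_act \<pi> g v)))"

definition jacobi_kernel ::
  "('f::{field,finite} \<Rightarrow> 'e::{field,finite}) \<Rightarrow> ('f \<Rightarrow> complex) \<Rightarrow> nat \<Rightarrow>
   ('e \<Rightarrow> complex) \<Rightarrow> 'e mat \<Rightarrow> complex" where
  "jacobi_kernel \<iota> \<psi> k \<chi> g =
     (if trivial_character \<chi>
      then norm_factor \<iota> (k\<^sup>2) * kondo_gauss \<iota> \<psi> k trivial_rep (\<lambda>_. 1) *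
           (\<Sum>x\<in>carrier (GL k). ext_character \<iota> \<psi> (mat_trace (x * (1\<^sub>m k + g))))
      else if det (1\<^sub>m k + g) \<noteq> 0 then \<chi> (det (1\<^sub>m k + g)) else 0)"

definition jacobi_dbl ::
  "('f::{field,finite} \<Rightarrow> 'e::{field,finite}) \<Rightarrow> ('f \<Rightarrow> complex) \<Rightarrow> nat \<Rightarrow>
   ('e mat, 'v::ab_group_add) rep \<Rightarrow> ('e \<Rightarrow> complex) \<Rightarrow> complex" where
  "jacobi_dbl \<iota> \<psi> k \<pi> \<chi> =
     scalar_of \<pi> (\<lambda>v. rep_scale \<pi> (norm_factor \<iota> (k\<^sup>2))
       (\<Sum>g\<in>carrier (GL k). rep_scale \<pi> (jacobi_kernel \<iota> \<psi> k \<chi> g) (rep_act \<pi> g v)))"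

end

theory Submission
  imports
    Defs
    "HOL-Number_Theory.Residues"
    "HOL-Computational_Algebra.Fundamental_Theorem_Algebra"
begin

text \<open>The kernel is a Fourier transform: for every \<open>\<chi>\<close>, trivial or not, \<open>\<Phi>\<^sub>\<chi>(g)\<close> is a constant times
  \<open>\<Sum>\<^sub>x \<chi>\<^sup>-\<^sup>1(det x) \<psi>(tr (x (1 + g)))\<close>, where Kondo's evaluation of \<open>\<Sum>\<^sub>x \<chi>(det x) \<psi>(tr x)\<close> and
  \<open>g(\<chi>) g(\<chi>\<^sup>-\<^sup>1) = \<chi>(-1) |E|\<close> give the constant. The phase splits as \<open>\<psi>(tr x) \<psi>(tr (x g))\<close>, so
  substituting \<open>h = x g\<close> factors the operator sum into \<open>\<Sum>\<^sub>y \<chi>(det y) \<psi>(tr y\<^sup>-\<^sup>1) \<tau>(y)\<close> times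
  \<open>\<Sum>\<^sub>h \<psi>(tr h) \<tau>(h)\<close>. Both are scalars by Schur's lemma, and the second is the transpose of the
  operator defining the Gauss sum of the contragredient.\<close>

section \<open>Trace and degree\<close>

lemma vector_space_ext_scale:
  assumes "field_hom \<iota>"
  shows "vector_space (ext_scale \<iota>)"
proof -
  interpret field_hom \<iota> by fact
  show ?thesis
    by unfold_locales (auto simp: ext_scale_def algebra_simps hom_add hom_mult)
qed

lemma ext_basis:
  assumes "field_hom \<iota>"
  shows "\<not> module.dependent (ext_scale \<iota>) (ext_basis \<iota>)"
    and "module.span (ext_scale \<iota>) (ext_basis \<iota>) = UNIV"
proof -
  interpret vector_space "ext_scale \<iota>" by (rule vector_space_ext_scale) fact
  have "\<exists>B. independent B \<and> span B = UNIV"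
    using basis_exists[of UNIV] by (metis top.extremum_uniqueI)
  from someI_ex[OF this]
  show "independent (ext_basis \<iota>)" "span (ext_basis \<iota>) = UNIV"
    by (auto simp: ext_basis_def)
qed

lemma card_ext_basis:
  fixes \<iota> :: "'f::field \<Rightarrow> 'e::{field,finite}"
  assumes "field_hom \<iota>"
  shows "card (ext_basis \<iota>) = ext_degree \<iota>"
proof -
  interpret vector_space "ext_scale \<iota>" by (rule vector_space_ext_scale) fact
  show ?thesis
    unfolding ext_degree_def
    using basis_card_eq_dim[of "ext_basis \<iota>" UNIV] ext_basis[OF assms] by auto
qed

lemma ext_trace_add:
  assumes "field_hom \<iota>"
  shows "ext_trace \<iota> (x + y) = ext_trace \<iota> x + ext_trace \<iota> y"
proof -
  interpret vector_space "ext_scale \<iota>" by (rule vector_space_ext_scale) fact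
  show ?thesis
    using ext_basis[OF assms]
    by (simp add: ext_trace_def distrib_right representation_add sum.distrib)
qed

text \<open>Multiplication by \<open>\<iota> a\<close> acts on every basis vector as the scalar
  \<open>a\<close>, so each diagonal coordinate is \<open>a\<close>. This supplies elements of
  prescribed trace when the degree is invertible.\<close>

lemma ext_trace_base:
  fixes \<iota> :: "'f::field \<Rightarrow> 'e::{field,finite}"
  assumes "field_hom \<iota>"
  shows "ext_trace \<iota> (\<iota> a) = of_nat (ext_degree \<iota>) * a"
proof -
  interpret vector_space "ext_scale \<iota>" by (rule vector_space_ext_scale) fact
  have "representation (ext_basis \<iota>) (\<iota> a * b) b = a" if "b \<in> ext_basis \<iota>" for b
    using representation_scale[OF ext_basis(1)[OF assms], of b a] ext_basis[OF assms] that
    by (simp add: representation_basis ext_scale_def)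
  then show ?thesis
    by (simp add: ext_trace_def card_ext_basis[OF assms])
qed

section \<open>Size of the extension, normalization, and the lifted additive character\<close>

text \<open>Coordinates in \<open>ext_basis \<iota>\<close> put \<open>'e\<close> in bijection with
  the functions from the basis to \<open>'f\<close>.\<close>

lemma card_ext_field:
  fixes \<iota> :: "'f::{field,finite} \<Rightarrow> 'e::{field,finite}"
  assumes "field_hom \<iota>"
  shows "CARD('e) = CARD('f) ^ ext_degree \<iota>"
proof -
  interpret vector_space "ext_scale \<iota>" by (rule vector_space_ext_scale) fact
  let ?B = "ext_basis \<iota>"
  note B = ext_basis[OF assms]
  have "bij_betw (\<lambda>x. \<lambda>b\<in>?B. representation ?B x b) UNIV (\<Pi>\<^sub>E b\<in>?B. UNIV)"
  proof (rule bij_betwI[where g = "\<lambda>f. \<Sum>b\<in>?B. ext_scale \<iota> (f b) b"])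
    fix x
    show "(\<Sum>b\<in>?B. ext_scale \<iota> ((\<lambda>b\<in>?B. representation ?B x b) b) b) = x"
      using sum_representation_eq[OF B(1), of x ?B] B by simp
  next
    fix f :: "'e \<Rightarrow> 'f" assume f: "f \<in> (\<Pi>\<^sub>E b\<in>?B. UNIV)"
    have "representation ?B (\<Sum>b\<in>?B. ext_scale \<iota> (f b) b) b = f b" if "b \<in> ?B" for b
    proof -
      have "representation ?B (\<Sum>b\<in>?B. ext_scale \<iota> (f b) b) b
            = (\<Sum>c\<in>?B. f c * representation ?B c b)"
        using B by (simp add: representation_sum representation_scale)
      also have "\<dots> = (\<Sum>c\<in>?B. if c = b then f c else 0)"
        using B by (intro sum.cong) (auto simp: representation_basis)
      finally show ?thesis using that by simp
    qed
    then show "(\<lambda>b\<in>?B. representation ?B (\<Sum>b\<in>?B. ext_scale \<iota> (f b) b) b) = f"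
      using f by (auto simp: fun_eq_iff restrict_def PiE_def extensional_def)
  qed auto
  from bij_betw_same_card[OF this] show ?thesis
    by (simp add: card_PiE card_ext_basis[OF assms])
qed

text \<open>Replaces real exponents by natural powers of \<open>|E|\<close> to the power
  \<open>-1/2\<close>, so that the later bookkeeping of constants is plain algebra.\<close>

lemma norm_factor_eq:
  fixes \<iota> :: "'f::{field,finite} \<Rightarrow> 'e::{field,finite}"
  assumes "field_hom \<iota>"
  shows "norm_factor \<iota> m = inverse (complex_of_real (sqrt (real CARD('e)))) ^ m"
proof -
  have "real CARD('f) powr (- (real (ext_degree \<iota>) * real m / 2))
      = inverse ((real CARD('f) powr real (ext_degree \<iota>)) powr (1/2)) powr real m"
    by (simp add: powr_powr powr_minus[symmetric])
  also have "\<dots> = inverse (sqrt (real CARD('e))) ^ m"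
    using assms by (simp add: powr_realpow powr_half_sqrt card_ext_field)
  finally show ?thesis by (simp add: norm_factor_def)
qed

lemma ext_character:
  fixes \<iota> :: "'f::{field,finite} \<Rightarrow> 'e::{field,finite}"
  assumes "field_hom \<iota>" "add_character \<psi>"
  shows "add_character (ext_character \<iota> \<psi>)"
  using assms by (auto simp: add_character_def ext_character_def ext_trace_add)

text \<open>In odd characteristic the degree is invertible, so the trace of the base field is onto.\<close>

lemma ext_character_nontrivial:
  fixes \<iota> :: "'f::{field,finite} \<Rightarrow> 'e::{field,finite}"
  assumes "field_hom \<iota>" "odd CARD('f)" "ext_degree \<iota> \<in> {1, 2}" "\<psi> x \<noteq> 1"
  shows "\<exists>y. ext_character \<iota> \<psi> y \<noteq> 1"
proof -
  \<comment> \<open>The cardinality vanishes in \<open>'f\<close>. If 2 vanished as well,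
    \<open>2 * m + 1 = 0\<close> would collapse to \<open>1 = 0\<close>.\<close>
  have "of_nat CARD('f) = (0::'f)"
    by (simp add: of_nat_eq_0_iff_char_dvd CHAR_dvd_CARD)
  moreover obtain m where "CARD('f) = 2 * m + 1"
    using assms(2) by (rule oddE)
  ultimately have "(2::'f) * of_nat m + 1 = 0" by (simp add: add.commute)
  then have "(2::'f) \<noteq> 0" by auto
  with assms(3) have deg: "of_nat (ext_degree \<iota>) \<noteq> (0::'f)" by auto
  \<comment> \<open>Dividing by the degree gives an element whose trace is exactly
    \<open>x\<close>.\<close>
  have "ext_character \<iota> \<psi> (\<iota> (x / of_nat (ext_degree \<iota>))) = \<psi> x"
    using deg by (simp add: ext_character_def ext_trace_base[OF assms(1)])
  with assms(4) show ?thesis by metis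
qed

section \<open>Gauss sums over the general linear group\<close>

lemma (in group) sum_left_translate:
  assumes "a \<in> carrier G"
  shows "(\<Sum>x\<in>carrier G. f (a \<otimes> x)) = (\<Sum>x\<in>carrier G. f x)"
  by (rule sum.reindex_bij_witness[of _ "\<lambda>x. inv a \<otimes> x" "\<lambda>x. a \<otimes> x"])
     (use assms in \<open>auto simp: m_assoc[symmetric]\<close>)

lemma (in group) sum_right_translate:
  assumes "a \<in> carrier G"
  shows "(\<Sum>x\<in>carrier G. f (x \<otimes> a)) = (\<Sum>x\<in>carrier G. f x)"
  by (rule sum.reindex_bij_witness[of _ "\<lambda>x. x \<otimes> inv a" "\<lambda>x. x \<otimes> a"])
     (use assms in \<open>auto simp: m_assoc\<close>)

lemma (in group) sum_inverse:
  "(\<Sum>x\<in>carrier G. f (inv x)) = (\<Sum>x\<in>carrier G. f x)"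
  by (rule sum.reindex_bij_witness[of _ "\<lambda>x. inv x" "\<lambda>x. inv x"]) auto

section \<open>The general linear group and matrix traces\<close>

lemma group_GL: "group (GL k :: 'a::comm_ring_1 mat monoid)"
proof -
  interpret ring "ring_mat TYPE('a) k ()" by (rule ring_mat)
  show ?thesis unfolding GL_def by (rule units_group)
qed

lemma GL_mult [simp]: "x \<otimes>\<^bsub>GL k\<^esub> y = x * y"
  and GL_one [simp]: "\<one>\<^bsub>GL k\<^esub> = 1\<^sub>m k"
  by (simp_all add: GL_def units_of_def ring_mat_def)

lemma carrier_GL: "carrier (GL k :: 'a::field mat monoid) = {A \<in> carrier_mat k k. det A \<noteq> 0}"
proof -
  have "A \<in> carrier_mat k k" if "A \<in> Units (ring_mat TYPE('a) k ())" for A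
    using that by (auto simp: Units_def ring_mat_def)
  then show ?thesis
    using unit_imp_det_non_zero[where ?'a = 'a and ?'b = unit] det_non_zero_imp_unit[where ?'a = 'a and ?'b = unit]
    by (auto simp: GL_def units_of_carrier)
qed

lemma finite_carrier_mat: "finite (carrier_mat m n :: 'a::finite mat set)"
proof (rule finite_subset)
  show "carrier_mat m n \<subseteq> mat m n ` (\<Pi>\<^sub>E p\<in>{..<m} \<times> {..<n}. (UNIV :: 'a set))"
  proof
    fix A :: "'a mat" assume A: "A \<in> carrier_mat m n"
    show "A \<in> mat m n ` (\<Pi>\<^sub>E p\<in>{..<m} \<times> {..<n}. (UNIV :: 'a set))"
      by (rule image_eqI[where x = "\<lambda>p\<in>{..<m} \<times> {..<n}. A $$ p"]) (use A in auto)
  qed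
qed (auto intro!: finite_PiE)

lemma finite_GL: "finite (carrier (GL k :: 'a::{field,finite} mat monoid))"
  by (rule finite_subset[OF _ finite_carrier_mat[of k k]]) (auto simp: carrier_GL)

lemma card_carrier_vec: "card (carrier_vec n :: 'a::finite vec set) = CARD('a) ^ n"
proof -
  have "bij_betw (vec n) (\<Pi>\<^sub>E i\<in>{..<n}. (UNIV :: 'a set)) (carrier_vec n)"
    by (rule bij_betwI[where g = "\<lambda>v. \<lambda>i\<in>{..<n}. v $ i"])
       (auto simp: fun_eq_iff PiE_def extensional_def)
  from bij_betw_same_card[OF this] show ?thesis by (simp add: card_PiE)
qed

lemma mat_trace_add:
  assumes "A \<in> carrier_mat n n" "B \<in> carrier_mat n n"
  shows "mat_trace (A + B) = mat_trace A + mat_trace B"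
  using assms by (simp add: mat_trace_def sum.distrib)

lemma mat_trace_mult:
  assumes "A \<in> carrier_mat n m" "B \<in> carrier_mat m n"
  shows "mat_trace (A * B) = (\<Sum>i<n. \<Sum>j<m. A $$ (i, j) * B $$ (j, i))"
  using assms by (simp add: mat_trace_def scalar_prod_def lessThan_atLeast0)

lemma mat_trace_mult_commute:
  assumes "A \<in> carrier_mat n m" "B \<in> carrier_mat m n"
  shows "mat_trace (A * B) = mat_trace (B * A)"
  unfolding mat_trace_mult[OF assms] mat_trace_mult[OF assms(2,1)]
  by (subst sum.swap) (simp add: mult.commute)

section \<open>Orthogonality of additive and multiplicative characters\<close>

lemma add_character_zero:
  assumes "add_character \<phi>"
  shows "\<phi> 0 = 1"
  using assms unfolding add_character_def by (metis add.right_neutral mult_cancel_left1)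

text \<open>For nonzero \<open>c\<close> some vector \<open>e\<close> has
  \<open>e \<bullet> c = y\<close> with \<open>\<phi> y \<noteq> 1\<close>. Translating by
  \<open>e\<close> multiplies the sum by \<open>\<phi> y\<close>, so it vanishes.\<close>

lemma sum_add_character_vec:
  fixes \<phi> :: "'a::{field,finite} \<Rightarrow> complex"
  assumes \<phi>: "add_character \<phi>" "\<exists>x. \<phi> x \<noteq> 1" and c: "c \<in> carrier_vec n"
  shows "(\<Sum>w\<in>carrier_vec n. \<phi> (w \<bullet> c)) = (if c = 0\<^sub>v n then of_nat (CARD('a) ^ n) else 0)"
proof (cases "c = 0\<^sub>v n")
  case True
  then show ?thesis by (simp add: add_character_zero[OF \<phi>(1)] card_carrier_vec)
next
  case False
  then obtain i where i: "i < n" "c $ i \<noteq> 0"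
    using c by (metis carrier_vecD eq_vecI index_zero_vec(1) index_zero_vec(2))
  obtain y where y: "\<phi> y \<noteq> 1" using \<phi> by blast
  define e where "e = (y / c $ i) \<cdot>\<^sub>v unit_vec n i"
  have e: "e \<in> carrier_vec n" "e \<bullet> c = y"
    using i c by (auto simp: e_def)
  have "(\<Sum>w\<in>carrier_vec n. \<phi> (w \<bullet> c)) = (\<Sum>w\<in>carrier_vec n. \<phi> ((w + e) \<bullet> c))"
  proof (rule sum.reindex_bij_witness[of _ "\<lambda>w. w + e" "\<lambda>w. w - e"])
    fix w :: "'a vec" assume w: "w \<in> carrier_vec n"
    show "w - e + e = w" "w + e - e = w" using w e(1) by auto
    then show "\<phi> ((w - e + e) \<bullet> c) = \<phi> (w \<bullet> c)" by simp
  qed (use e in auto)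
  also have "\<dots> = (\<Sum>w\<in>carrier_vec n. \<phi> (w \<bullet> c)) * \<phi> y"
    unfolding sum_distrib_right
    using \<phi>(1) e c by (intro sum.cong) (simp_all add: add_scalar_prod_distrib[of _ n] add_character_def)
  finally show ?thesis using y False by simp
qed

lemma sum_add_character:
  fixes \<phi> :: "'a::{field,finite} \<Rightarrow> complex"
  assumes \<phi>: "add_character \<phi>" "\<exists>x. \<phi> x \<noteq> 1"
  shows "(\<Sum>x\<in>UNIV. \<phi> (x * a)) = (if a = 0 then of_nat CARD('a) else 0)"
proof (cases "a = 0")
  case True
  then show ?thesis by (simp add: add_character_zero[OF \<phi>(1)])
next
  case False
  obtain y where y: "\<phi> y \<noteq> 1" using \<phi> by blast
  have "(\<Sum>x\<in>UNIV. \<phi> (x * a)) = (\<Sum>x\<in>UNIV. \<phi> ((x + y / a) * a))"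
    by (rule sum.reindex_bij_witness[of _ "\<lambda>x. x + y / a" "\<lambda>x. x - y / a"]) auto
  also have "\<dots> = (\<Sum>x\<in>UNIV. \<phi> (x * a)) * \<phi> y"
    using \<phi>(1) False by (simp add: sum_distrib_right add_character_def distrib_right)
  finally show ?thesis using y False by simp
qed

lemma mult_character_one:
  assumes "mult_character \<chi>"
  shows "\<chi> 1 = 1"
  using assms unfolding mult_character_def by (metis mult_cancel_left1 zero_neq_one)

lemma mult_character_inverse:
  assumes "mult_character \<chi>"
  shows "mult_character (\<lambda>x. inverse (\<chi> x))"
  using assms by (auto simp: mult_character_def)

lemma mult_character_divide:
  assumes "mult_character \<chi>" "x \<noteq> 0" "y \<noteq> 0"
  shows "\<chi> (x / y) = \<chi> x / \<chi> y"
proof -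
  have "\<chi> x = \<chi> (x / y) * \<chi> y"
    using assms unfolding mult_character_def by (metis divide_eq_0_iff nonzero_eq_divide_eq)
  then show ?thesis using assms by (auto simp: mult_character_def)
qed

text \<open>Multiplying the variable by some \<open>y\<close> with
  \<open>\<chi> y \<noteq> 1\<close> scales the sum by \<open>\<chi> y\<close>.\<close>

lemma sum_mult_character:
  fixes \<chi> :: "'a::{field,finite} \<Rightarrow> complex"
  assumes \<chi>: "mult_character \<chi>" "\<not> trivial_character \<chi>"
  shows "(\<Sum>x\<in>{x. x \<noteq> 0}. \<chi> x) = 0"
proof -
  obtain y where y: "y \<noteq> 0" "\<chi> y \<noteq> 1" using \<chi> by (auto simp: trivial_character_def)
  have "(\<Sum>x\<in>{x. x \<noteq> 0}. \<chi> x) = (\<Sum>x\<in>{x. x \<noteq> 0}. \<chi> (x * y))"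
    by (rule sum.reindex_bij_witness[of _ "\<lambda>x. x * y" "\<lambda>x. x / y"]) (use y in auto)
  also have "\<dots> = (\<Sum>x\<in>{x. x \<noteq> 0}. \<chi> x) * \<chi> y"
    unfolding sum_distrib_right
    using \<chi>(1) y by (intro sum.cong) (auto simp: mult_character_def)
  finally show ?thesis using y by simp
qed

section \<open>Gauss sums over the field and over invertible matrices\<close>

text \<open>Unnormalized, and with \<open>\<chi>\<close> itself where \<open>abelian_gauss\<close>
  has the inverse: up to sign and normalization this is the abelian Gauss sum of the inverse
  character.\<close>

definition gauss_sum :: "('a::{field,finite} \<Rightarrow> complex) \<Rightarrow> ('a \<Rightarrow> complex) \<Rightarrow> complex" where
  "gauss_sum \<phi> \<chi> = (\<Sum>x\<in>{x. x \<noteq> 0}. \<chi> x * \<phi> x)"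

lemma gauss_sum_trivial:
  assumes \<phi>: "add_character \<phi>" "\<exists>x. \<phi> x \<noteq> 1" and \<chi>: "trivial_character \<chi>"
  shows "gauss_sum \<phi> \<chi> = - 1"
proof -
  have "gauss_sum \<phi> \<chi> = (\<Sum>x\<in>UNIV - {0}. \<phi> x)"
    unfolding gauss_sum_def using \<chi> by (intro sum.cong) (auto simp: trivial_character_def)
  also have "\<dots> = - 1"
    using sum_add_character[OF \<phi>, of 1] by (simp add: sum_diff1 add_character_zero[OF \<phi>(1)])
  finally show ?thesis .
qed

text \<open>Put \<open>t = x / y\<close> in the double sum. The sum over \<open>y\<close> is
  \<open>|E| - 1\<close> at \<open>t = -1\<close> and \<open>-1\<close> elsewhere; the terms
  \<open>-1\<close> add up to minus the sum of \<open>\<chi>\<close>, which is 0 because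
  \<open>\<chi>\<close> is nontrivial.\<close>

lemma gauss_sum_inverse:
  fixes \<phi> \<chi> :: "'a::{field,finite} \<Rightarrow> complex"
  assumes \<phi>: "add_character \<phi>" "\<exists>x. \<phi> x \<noteq> 1"
    and \<chi>: "mult_character \<chi>" "\<not> trivial_character \<chi>"
  shows "gauss_sum \<phi> \<chi> * gauss_sum \<phi> (\<lambda>x. inverse (\<chi> x)) = \<chi> (- 1) * of_nat CARD('a)"
proof -
  let ?N = "{x :: 'a. x \<noteq> 0}"
  have "gauss_sum \<phi> \<chi> * gauss_sum \<phi> (\<lambda>x. inverse (\<chi> x))
      = (\<Sum>y\<in>?N. \<Sum>x\<in>?N. \<chi> (x / y) * \<phi> (x + y))"
    unfolding gauss_sum_def sum_product using \<phi>(1)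
    by (subst sum.swap, intro sum.cong refl)
       (simp add: mult_character_divide[OF \<chi>(1)] add_character_def inverse_eq_divide)
  also have "\<dots> = (\<Sum>y\<in>?N. \<Sum>t\<in>?N. \<chi> t * \<phi> (y * (t + 1)))"
  proof (rule sum.cong[OF refl])
    fix y :: 'a assume "y \<in> ?N"
    then show "(\<Sum>x\<in>?N. \<chi> (x / y) * \<phi> (x + y)) = (\<Sum>t\<in>?N. \<chi> t * \<phi> (y * (t + 1)))"
      by (intro sum.reindex_bij_witness[of _ "\<lambda>t. t * y" "\<lambda>x. x / y"])
         (auto simp: distrib_left mult.commute)
  qed
  also have "\<dots> = (\<Sum>t\<in>?N. \<chi> t * (\<Sum>y\<in>?N. \<phi> (y * (t + 1))))"
    by (subst sum.swap) (simp add: sum_distrib_left)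
  also have "\<dots> = (\<Sum>t\<in>?N. (if t = - 1 then \<chi> (- 1) * of_nat CARD('a) else 0) - \<chi> t)"
  proof (rule sum.cong[OF refl])
    fix t :: 'a
    have "(\<Sum>y\<in>?N. \<phi> (y * (t + 1))) = (\<Sum>y\<in>UNIV - {0}. \<phi> (y * (t + 1)))"
      by (intro sum.cong) auto
    also have "\<dots> = (if t = - 1 then of_nat CARD('a) else 0) - 1"
      using sum_add_character[OF \<phi>, of "t + 1"]
      by (simp add: sum_diff1 add_character_zero[OF \<phi>(1)] add_eq_0_iff2)
    finally show "\<chi> t * (\<Sum>y\<in>?N. \<phi> (y * (t + 1)))
        = (if t = - 1 then \<chi> (- 1) * of_nat CARD('a) else 0) - \<chi> t"
      by (simp only:) (auto simp: algebra_simps)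
  qed
  also have "\<dots> = \<chi> (- 1) * of_nat CARD('a)"
    by (simp add: sum_subtractf sum_mult_character[OF \<chi>])
  finally show ?thesis .
qed

text \<open>Averaging over the translates \<open>g * u w\<close>, with \<open>u w\<close> unipotent and supported in the first row,
  kills every \<open>g\<close> whose first column has a nonzero entry below the diagonal; the remaining \<open>g\<close> are
  block upper triangular, which reduces \<open>Suc n\<close> to \<open>n\<close>.\<close>

lemma GL_gauss_sum:
  fixes \<phi> \<chi> :: "'a::{field,finite} \<Rightarrow> complex"
  assumes \<phi>: "add_character \<phi>" "\<exists>x. \<phi> x \<noteq> 1" and \<chi>: "mult_character \<chi>"
  shows "(\<Sum>g\<in>carrier (GL n). \<chi> (det g) * \<phi> (mat_trace g))
       = of_nat CARD('a) ^ (n * (n - 1) div 2) * gauss_sum \<phi> \<chi> ^ n"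
proof (induction n)
  case 0
  have "(1\<^sub>m 0 :: 'a mat) \<in> carrier (GL 0)" by (auto simp: carrier_GL)
  then have "carrier (GL 0 :: 'a mat monoid) = {1\<^sub>m 0}"
    by (auto simp: carrier_GL)
  then show ?case
    by (simp add: mat_trace_def mult_character_one[OF \<chi>] add_character_zero[OF \<phi>(1)])
next
  case (Suc n)
  let ?G = "carrier (GL (Suc n)) :: 'a mat set"
  let ?V = "carrier_vec n :: 'a vec set"
  interpret group "GL (Suc n) :: 'a mat monoid" by (rule group_GL)
  define f where "f g = \<chi> (det g) * \<phi> (mat_trace g)" for g :: "'a mat"
  define c where "c g = vec n (\<lambda>i. g $$ (Suc i, 0))" for g :: "'a mat"
  define u where "u w = mat (Suc n) (Suc n)
    (\<lambda>(i, j). if i = j then 1 else if i = 0 then w $ (j - 1) else 0)" for w :: "'a vec"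
  have c_carrier: "c g \<in> ?V" for g by (simp add: c_def)
  have u_carrier: "u w \<in> carrier_mat (Suc n) (Suc n)" for w by (simp add: u_def)
  have det_u: "det (u w) = 1" for w
  proof -
    have "det (u w) = prod_list (diag_mat (u w))"
      by (rule det_upper_triangular[OF _ u_carrier]) (auto simp: u_def)
    also have "diag_mat (u w) = map (\<lambda>_. 1) [0..<Suc n]"
      by (auto simp: diag_mat_def u_def simp del: upt_Suc)
    finally show ?thesis by (simp add: map_replicate_const del: upt_Suc replicate_Suc)
  qed
  have u_GL: "u w \<in> ?G" for w using det_u u_carrier by (simp add: carrier_GL)
  \<comment> \<open>Right multiplication by \<open>u w\<close> adds multiples of column 0, with
    coefficients from \<open>w\<close>, to the other columns. The determinant stays and the trace
    grows by \<open>w \<bullet> c g\<close>.\<close>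
  have f_u: "f (g * u w) = f g * \<phi> (w \<bullet> c g)" if g: "g \<in> ?G" and w: "w \<in> ?V" for g w
  proof -
    have g': "g \<in> carrier_mat (Suc n) (Suc n)" using g by (simp add: carrier_GL)
    have "(\<Sum>j<Suc n. g $$ (i, j) * u w $$ (j, i))
        = g $$ (i, i) + (if i = 0 then 0 else w $ (i - 1) * g $$ (i, 0))" if "i < Suc n" for i
    proof -
      have "(\<Sum>j<Suc n. g $$ (i, j) * u w $$ (j, i))
          = (\<Sum>j<Suc n. (if j = i then g $$ (i, i) else 0)
               + (if j = 0 then if i = 0 then 0 else w $ (i - 1) * g $$ (i, 0) else 0))"
        using that by (intro sum.cong) (auto simp: u_def)
      then show ?thesis using that by (simp only: sum.distrib) simp
    qed
    then have "mat_trace (g * u w)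
        = (\<Sum>i<Suc n. g $$ (i, i) + (if i = 0 then 0 else w $ (i - 1) * g $$ (i, 0)))"
      by (simp only: mat_trace_mult[OF g' u_carrier] cong: sum.cong_simp) simp
    also have "\<dots> = mat_trace g + w \<bullet> c g"
      using g' w by (simp add: mat_trace_def sum.distrib scalar_prod_def c_def lessThan_atLeast0
          sum.atLeast0_lessThan_Suc_shift del: sum.lessThan_Suc sum.op_ivl_Suc)
    finally show ?thesis
      using \<phi>(1) det_u by (simp add: f_def det_mult[OF g' u_carrier] add_character_def)
  qed
  \<comment> \<open>Each translation by \<open>u w\<close> preserves the sum, so summing over all
    \<open>w\<close> only multiplies it by the number of vectors; orthogonality in \<open>w\<close>
    then selects \<open>c g = 0\<close>.\<close>
  have "of_nat (CARD('a) ^ n) * (\<Sum>g\<in>?G. f g) = (\<Sum>w\<in>?V. \<Sum>g\<in>?G. f (g * u w))"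
    using sum_right_translate[OF u_GL, of f] by (simp add: card_carrier_vec)
  also have "\<dots> = (\<Sum>g\<in>?G. f g * (\<Sum>w\<in>?V. \<phi> (w \<bullet> c g)))"
    by (subst sum.swap) (simp add: f_u sum_distrib_left)
  also have "\<dots> = (\<Sum>g\<in>?G. if c g = 0\<^sub>v n then of_nat (CARD('a) ^ n) * f g else 0)"
    by (intro sum.cong refl) (simp add: sum_add_character_vec[OF \<phi> c_carrier])
  also have "\<dots> = of_nat (CARD('a) ^ n) * (\<Sum>g\<in>{g \<in> ?G. c g = 0\<^sub>v n}. f g)"
    by (simp add: sum.inter_filter[OF finite_GL] sum_distrib_left if_distrib cong: if_cong)
  finally have "(\<Sum>g\<in>?G. f g) = (\<Sum>g\<in>{g \<in> ?G. c g = 0\<^sub>v n}. f g)"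
    by simp
  also have "\<dots> = (\<Sum>(a, r, h)\<in>{x. x \<noteq> 0} \<times> ?V \<times> carrier (GL n).
      \<chi> a * \<phi> a * (\<chi> (det h) * \<phi> (mat_trace h)))"
  proof -
    \<comment> \<open>A surviving \<open>g\<close> is determined by its corner entry
      \<open>a\<close>, the rest \<open>r\<close> of its first row and its lower right block
      \<open>h\<close>. \<open>B\<close> assembles these and \<open>C\<close> reads them
      off.\<close>
    define B where "B = (\<lambda>(a, r, h).
      four_block_mat (mat 1 1 (\<lambda>_. a)) (mat 1 n (\<lambda>(i, j). r $ j)) (0\<^sub>m n 1) (h :: 'a mat))"
    define C where "C g = (g $$ (0, 0), vec n (\<lambda>j. g $$ (0, Suc j)),
      mat n n (\<lambda>(i, j). g $$ (Suc i, Suc j)))" for g :: "'a mat"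
    have det_B: "det (B (a, r, h)) = a * det h"
      and trace_B: "mat_trace (B (a, r, h)) = a + mat_trace h"
      and B_carrier: "B (a, r, h) \<in> carrier_mat (Suc n) (Suc n)"
      and c_B: "c (B (a, r, h)) = 0\<^sub>v n"
      and C_B: "r \<in> ?V \<Longrightarrow> C (B (a, r, h)) = (a, r, h)"
      if h: "h \<in> carrier_mat n n" for a r h
    proof -
      have "det (B (a, r, h)) = det (mat 1 1 (\<lambda>_. a)) * det h"
        unfolding B_def prod.case
        by (rule det_four_block_mat_lower_left_zero[of _ 1 _ n _ ]) (use h in auto)
      then show "det (B (a, r, h)) = a * det h" by (simp add: det_single)
      show "mat_trace (B (a, r, h)) = a + mat_trace h"
        using h by (simp add: mat_trace_def B_def sum.lessThan_Suc_shift del: sum.lessThan_Suc)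
      show "B (a, r, h) \<in> carrier_mat (Suc n) (Suc n)"
        using h by (auto simp: B_def)
      show "c (B (a, r, h)) = 0\<^sub>v n" using h by (auto simp: B_def c_def)
      show "C (B (a, r, h)) = (a, r, h)" if "r \<in> ?V"
        using h that by (auto simp: B_def C_def)
    qed
    have B_C: "B (C g) = g" if g: "g \<in> carrier_mat (Suc n) (Suc n)" and "c g = 0\<^sub>v n" for g
    proof -
      have "g $$ (i, 0) = 0" if "0 < i" "i < Suc n" for i
        using arg_cong[OF \<open>c g = 0\<^sub>v n\<close>, of "\<lambda>v. v $ (i - 1)"] that by (cases i) (simp_all add: c_def)
      then show ?thesis
        using g by (intro eq_matI) (auto simp: B_def C_def less_Suc_eq_0_disj)
    qed
    have C_h: "snd (snd (C g)) \<in> carrier_mat n n" for g by (simp add: C_def)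
    \<comment> \<open>Through this factorization, \<open>det g \<noteq> 0\<close> forces both a
      nonzero corner and an invertible block.\<close>
    have det_C: "det g = fst (C g) * det (snd (snd (C g)))"
      if g: "g \<in> carrier_mat (Suc n) (Suc n)" and "c g = 0\<^sub>v n" for g
      using det_B[OF C_h, of "fst (C g)" "fst (snd (C g))" g] B_C[OF that] by simp
    show ?thesis
    proof (rule sum.reindex_bij_witness[of _ B C])
      fix g assume "g \<in> {g \<in> ?G. c g = 0\<^sub>v n}"
      then have g: "g \<in> carrier_mat (Suc n) (Suc n)" "c g = 0\<^sub>v n" "det g \<noteq> 0"
        by (auto simp: carrier_GL)
      show "B (C g) = g" using B_C[OF g(1,2)] .
      show C: "C g \<in> {x. x \<noteq> 0} \<times> ?V \<times> carrier (GL n)"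
        using g(3) C_h[of g] unfolding det_C[OF g(1,2)] by (auto simp: C_def carrier_GL)
      obtain a r h where ar: "C g = (a, r, h)" by (metis prod_cases3)
      have "h \<in> carrier_mat n n" using C_h[of g] ar by simp
      from det_B[OF this] trace_B[OF this]
      have "f (B (a, r, h)) = \<chi> a * \<phi> a * (\<chi> (det h) * \<phi> (mat_trace h))"
        using C ar \<phi>(1) \<chi> by (simp add: f_def add_character_def mult_character_def carrier_GL)
      then show "(case C g of (a, r, h) \<Rightarrow> \<chi> a * \<phi> a * (\<chi> (det h) * \<phi> (mat_trace h))) = f g"
        using ar \<open>B (C g) = g\<close> by simp
    qed (auto simp: carrier_GL det_B B_carrier c_B C_B)
  qed
  \<comment> \<open>The summand does not involve \<open>r\<close>, which contributes the factor
    \<open>CARD('a) ^ n\<close>; the corner contributes one field Gauss sum.\<close>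
  also have "\<dots> = gauss_sum \<phi> \<chi> * (of_nat CARD('a) ^ n *
      (\<Sum>g\<in>carrier (GL n). \<chi> (det g) * \<phi> (mat_trace g)))"
    by (simp add: sum.cartesian_product[symmetric] gauss_sum_def sum_product card_carrier_vec
        sum_distrib_left mult_ac, rule sum.swap)
  also have "\<dots> = of_nat CARD('a) ^ (n + n * (n - 1) div 2) * gauss_sum \<phi> \<chi> ^ Suc n"
    unfolding Suc.IH by (simp add: power_add)
  also have "n + n * (n - 1) div 2 = Suc n * (Suc n - 1) div 2"
    by (cases n) auto
  finally show ?case by (simp only: f_def)
qed

text \<open>Translating \<open>x\<close> by the invertible \<open>A\<close> leaves the trace term in
  \<open>x\<close> alone and moves \<open>\<chi> (det A)\<close> in front of the sum.\<close>

lemma GL_gauss_sum_twist: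
  fixes \<chi> :: "'a::{field,finite} \<Rightarrow> complex"
  assumes \<chi>: "mult_character \<chi>" and A: "A \<in> carrier (GL k)"
  shows "(\<Sum>x\<in>carrier (GL k). inverse (\<chi> (det x)) * \<phi> (mat_trace (x * A)))
       = \<chi> (det A) * (\<Sum>x\<in>carrier (GL k). inverse (\<chi> (det x)) * \<phi> (mat_trace x))"
proof -
  interpret group "GL k :: 'a mat monoid" by (rule group_GL)
  define f where "f x = \<chi> (det A) * (inverse (\<chi> (det x)) * \<phi> (mat_trace x))" for x
  have A': "A \<in> carrier_mat k k" "\<chi> (det A) \<noteq> 0"
    using A \<chi> by (auto simp: carrier_GL mult_character_def)
  have "(\<Sum>x\<in>carrier (GL k). inverse (\<chi> (det x)) * \<phi> (mat_trace (x * A)))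
      = (\<Sum>x\<in>carrier (GL k). f (x * A))"
    using \<chi> A A'
    by (intro sum.cong) (auto simp: f_def carrier_GL mult_character_def det_mult[of _ k])
  also have "\<dots> = (\<Sum>x\<in>carrier (GL k). f x)"
    using sum_right_translate[OF A, of f] by simp
  finally show ?thesis by (simp add: f_def sum_distrib_left)
qed

text \<open>A singular \<open>A\<close> is fixed under right multiplication by some \<open>h\<close> of any prescribed nonzero
  determinant: perturb the identity in one column along a kernel vector.\<close>

lemma GL_gauss_sum_twist_singular:
  fixes \<chi> :: "'a::{field,finite} \<Rightarrow> complex"
  assumes \<chi>: "mult_character \<chi>" "\<not> trivial_character \<chi>"
    and A: "A \<in> carrier_mat k k" "det A = 0"
  shows "(\<Sum>x\<in>carrier (GL k). inverse (\<chi> (det x)) * \<phi> (mat_trace (x * A))) = 0"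
proof -
  interpret group "GL k :: 'a mat monoid" by (rule group_GL)
  obtain t where t: "t \<noteq> 0" "\<chi> t \<noteq> 1" using \<chi> by (auto simp: trivial_character_def)
  obtain v where v: "v \<in> carrier_vec k" "v \<noteq> 0\<^sub>v k" "A *\<^sub>v v = 0\<^sub>v k"
    using A det_0_iff_vec_prod_zero by blast
  then obtain i where i: "i < k" "v $ i \<noteq> 0"
    by (metis carrier_vecD eq_vecI index_zero_vec(1) index_zero_vec(2))
  \<comment> \<open>With this entry \<open>h\<close> is the identity plus the rank one matrix formed
    from \<open>v\<close> and \<open>w\<close>, and its determinant is
    \<open>1 + v $ i * w i = t\<close>. Also \<open>A * h = A\<close>, because \<open>A\<close>
    kills \<open>v\<close>.\<close>
  define w where "w b = (if b = i then (t - 1) / v $ i else 0)" for b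
  define h where "h = mat k k (\<lambda>(a, b). (if a = b then 1 else 0) + v $ a * w b)"
  have h: "h \<in> carrier_mat k k" by (simp add: h_def)
  have "A * h = A"
  proof (rule eq_matI)
    fix a b assume ab: "a < dim_row A" "b < dim_col A"
    have "(A * h) $$ (a, b) = (\<Sum>j<k. A $$ (a, j) * ((if j = b then 1 else 0) + v $ j * w b))"
      using ab A by (simp add: scalar_prod_def lessThan_atLeast0 h_def)
    also have "\<dots> = (\<Sum>j<k. if j = b then A $$ (a, b) else 0) + (\<Sum>j<k. A $$ (a, j) * v $ j) * w b"
      by (simp only: sum_distrib_right sum.distrib[symmetric])
         (intro sum.cong, auto simp: algebra_simps)
    also have "(\<Sum>j<k. A $$ (a, j) * v $ j) = (A *\<^sub>v v) $ a"
      using ab A v(1) by (simp add: scalar_prod_def lessThan_atLeast0)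
    finally show "(A * h) $$ (a, b) = A $$ (a, b)"
      using ab A v(3) by simp
  qed (use A h in auto)
  have "det h = t"
  proof -
    \<comment> \<open>Only column \<open>i\<close> differs from the identity, so this minor is the
      identity. Row \<open>i\<close> of \<open>h\<close> has \<open>t\<close> as its sole nonzero
      entry, and Laplace expansion along it gives \<open>t\<close>.\<close>
    have "mat_delete h i i = 1\<^sub>m (k - 1)"
    proof (rule eq_matI)
      fix a b assume ab: "a < dim_row (1\<^sub>m (k - 1) :: 'a mat)" "b < dim_col (1\<^sub>m (k - 1) :: 'a mat)"
      then show "mat_delete h i i $$ (a, b) = 1\<^sub>m (k - 1) $$ (a, b)"
        using i h by (auto simp: mat_delete_def h_def w_def)
    qed (use h in auto)
    then have "cofactor h i i = 1" by (simp add: cofactor_def)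
    have "h $$ (i, j) = (if j = i then t else 0)" if "j < k" for j
      using i that by (auto simp: h_def w_def)
    then have "det h = (\<Sum>j<k. if j = i then t * cofactor h i i else 0)"
      unfolding laplace_expansion_row[OF h i(1)] by (intro sum.cong) auto
    then show ?thesis using i \<open>cofactor h i i = 1\<close> by simp
  qed
  then have h_GL: "h \<in> carrier (GL k)" using h t by (simp add: carrier_GL)
  define S where "S = (\<Sum>x\<in>carrier (GL k). inverse (\<chi> (det x)) * \<phi> (mat_trace (x * A)))"
  \<comment> \<open>Cyclicity of the trace carries \<open>h\<close> to the right of
    \<open>A\<close>, which absorbs it. Left translation by \<open>h\<close> thus scales
    \<open>S\<close> by \<open>inverse (\<chi> t)\<close>, which is not 1.\<close>
  have "inverse (\<chi> (det (h * x))) * \<phi> (mat_trace (h * x * A))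
      = inverse (\<chi> t) * (inverse (\<chi> (det x)) * \<phi> (mat_trace (x * A)))"
    if "x \<in> carrier (GL k)" for x
  proof -
    have x: "x \<in> carrier_mat k k" "det x \<noteq> 0" using that by (auto simp: carrier_GL)
    have "mat_trace (h * x * A) = mat_trace (x * A * h)"
      using mat_trace_mult_commute[of h k k "x * A"] assoc_mult_mat[OF h x(1) A(1)] h x A by simp
    also have "x * A * h = x * A"
      using assoc_mult_mat[OF x(1) A(1) h] \<open>A * h = A\<close> by simp
    finally have "mat_trace (h * x * A) = mat_trace (x * A)" .
    moreover have "\<chi> (det (h * x)) = \<chi> t * \<chi> (det x)"
      using \<chi>(1) t(1) x \<open>det h = t\<close> by (simp add: det_mult[OF h x(1)] mult_character_def)
    ultimately show ?thesis by simp
  qed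
  then have "S = inverse (\<chi> t) * S"
    using sum_left_translate[OF h_GL, of "\<lambda>x. inverse (\<chi> (det x)) * \<phi> (mat_trace (x * A))"]
    by (simp add: S_def sum_distrib_left)
  moreover have "inverse (\<chi> t) \<noteq> 1" using t(2) by (simp add: inverse_eq_1_iff)
  ultimately show ?thesis by (simp add: S_def)
qed

section \<open>Schur's lemma for class sums\<close>

text \<open>The iterates of a vector under \<open>T\<close> are linearly dependent, so some nonzero polynomial in \<open>T\<close>
  annihilates it; splitting off linear factors one at a time produces an eigenvector.\<close>

lemma exists_eigenvector:
  fixes scale :: "complex \<Rightarrow> 'v::ab_group_add \<Rightarrow> 'v"
  assumes vs: "vector_space scale"
    and sub: "module.subspace scale V"
    and fin: "finite B" "V \<subseteq> module.span scale B"
    and ne: "V \<noteq> {0}"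
    and T_V: "\<And>v. v \<in> V \<Longrightarrow> T v \<in> V"
    and T_add: "\<And>v w. v \<in> V \<Longrightarrow> w \<in> V \<Longrightarrow> T (v + w) = T v + T w"
    and T_scale: "\<And>c v. v \<in> V \<Longrightarrow> T (scale c v) = scale c (T v)"
  shows "\<exists>c v. v \<in> V \<and> v \<noteq> 0 \<and> T v = scale c v"
proof -
  interpret vector_space scale by fact
  have V0: "0 \<in> V" using sub by (rule subspace_0)
  then obtain v where v: "v \<in> V" "v \<noteq> 0" using ne by blast
  have T0: "T 0 = 0" using T_scale[OF V0, of 0] by simp
  \<comment> \<open>\<open>E p\<close> is the polynomial \<open>p\<close> in \<open>T\<close>
    applied to \<open>v\<close>, evaluated by Horner's scheme.\<close>
  define E where "E p = fold_coeffs (\<lambda>a w. scale a v + T w) p 0" for p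
  have E_0 [simp]: "E 0 = 0" by (simp add: E_def)
  have E_pCons [simp]: "E (pCons a p) = scale a v + T (E p)" for a p
    by (cases "a = 0 \<and> p = 0") (auto simp: E_def T0)
  have E_V: "E p \<in> V" for p
    by (induction p) (auto intro!: V0 subspace_add[OF sub] subspace_scale[OF sub] v T_V)
  have E_add: "E (p + q) = E p + E q" for p q
    by (induction p q rule: poly_induct2) (simp_all add: T_add E_V scale_left_distrib)
  have E_smult: "E (smult c p) = scale c (E p)" for c p
    by (induction p) (simp_all add: T_scale E_V scale_right_distrib)
  have E_monom: "E (Polynomial.monom c n) = scale c ((T ^^ n) v)" for c n
  proof (induction n)
    case 0
    show ?case by (simp add: Polynomial.monom_0 T0)
  next
    case (Suc n)
    have "(T ^^ n) v \<in> V" by (induction n) (auto intro: v T_V)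
    then show ?case using Suc by (simp add: Polynomial.monom_Suc T_scale)
  qed
  have E_sum: "E (\<Sum>x\<in>A. f x) = (\<Sum>x\<in>A. E (f x))" for f :: "'b \<Rightarrow> complex poly" and A
    by (induction A rule: infinite_finite_induct) (simp_all add: E_add)
  have "\<exists>p. p \<noteq> 0 \<and> E p = 0"
  \<comment> \<open>Dependence is a property of sets, so coinciding iterates are treated apart: they
    give a difference of two monomials. Otherwise infinitely many iterates lie in a finitely spanned
    space.\<close>
  proof (cases "inj (\<lambda>i. (T ^^ i) v)")
    case False
    then obtain i j where ij: "i \<noteq> j" "(T ^^ i) v = (T ^^ j) v"
      by (auto simp: inj_on_def)
    let ?p = "Polynomial.monom 1 i + Polynomial.monom (- 1) j :: complex poly"
    have "Polynomial.coeff ?p i = 1" using ij by simp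
    then have "?p \<noteq> 0" by (metis coeff_0 zero_neq_one)
    moreover have "E ?p = 0" using ij by (simp add: E_add E_monom)
    ultimately show ?thesis by blast
  next
    case True
    define S where "S = range (\<lambda>i. (T ^^ i) v)"
    have "(T ^^ i) v \<in> V" for i by (induction i) (auto intro: v T_V)
    then have "S \<subseteq> span B" using fin(2) by (auto simp: S_def)
    moreover have "infinite S" using True by (simp add: S_def finite_image_iff)
    ultimately have "dependent S" using independent_span_bound[OF fin(1)] by blast
    then obtain t u where t: "finite t" "t \<subseteq> S" "(\<Sum>w\<in>t. scale (u w) w) = 0"
      and "\<exists>w\<in>t. u w \<noteq> 0" by (auto simp: dependent_explicit)
    then obtain w where w: "w \<in> t" "u w \<noteq> 0" by blast
    \<comment> \<open>A choice of exponent for each vector of the relation. Distinct vectors get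
      distinct exponents, so the coefficients in \<open>?p\<close> cannot cancel.\<close>
    define idx where "idx = inv_into UNIV (\<lambda>i. (T ^^ i) v)"
    have idx: "(T ^^ idx y) v = y" if "y \<in> t" for y
    proof -
      have "y \<in> range (\<lambda>i. (T ^^ i) v)" using that t(2) by (auto simp: S_def)
      then show ?thesis unfolding idx_def by (rule f_inv_into_f)
    qed
    let ?p = "\<Sum>y\<in>t. Polynomial.monom (u y) (idx y)"
    have "idx y = idx w \<longleftrightarrow> y = w" if "y \<in> t" for y
      using idx[OF that] idx[OF w(1)] by metis
    then have "Polynomial.coeff ?p (idx w) = (\<Sum>y\<in>t. if y = w then u w else 0)"
      by (simp add: coeff_sum) (intro sum.cong, auto)
    then have "Polynomial.coeff ?p (idx w) \<noteq> 0" using t(1) w by simp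
    then have "?p \<noteq> 0" by (metis coeff_0)
    moreover have "E ?p = 0" using t(3) by (simp add: E_sum E_monom idx)
    ultimately show ?thesis by blast
  qed
  then obtain p where "p \<noteq> 0" "E p = 0" by blast
  then show ?thesis
  proof (induction "degree p" arbitrary: p rule: less_induct)
    case less
    show ?case
    proof (cases "degree p = 0")
      case True
      \<comment> \<open>A nonzero constant would give \<open>scale a v = 0\<close> with
        \<open>v \<noteq> 0\<close>, so this case is contradictory.\<close>
      then obtain a where "p = [:a:]" by (rule degree_eq_zeroE)
      then show ?thesis using less.prems v by (simp add: T0)
    next
      case False
      then have "\<not> Fundamental_Theorem_Algebra.constant (poly p)" by (simp add: constant_degree)
      then obtain c where "poly p c = 0"
        using fundamental_theorem_of_algebra by blast
      then obtain q where q: "p = [:- c, 1:] * q" by (auto simp: poly_eq_0_iff_dvd)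
      have "q \<noteq> 0" using q less.prems by auto
      then have "degree p = degree [:- c, 1:] + degree q"
        unfolding q by (intro degree_mult_eq) auto
      then have "degree q < degree p" by simp
      have "E p = scale (- c) (E q) + T (E q)"
      proof -
        have "p = Polynomial.smult (- c) q + pCons 0 q" by (simp add: q)
        then show ?thesis by (simp only: E_add E_smult E_pCons) simp
      qed
      \<comment> \<open>Either \<open>E q\<close> is nonzero and is the eigenvector sought, or
        \<open>q\<close> annihilates \<open>v\<close> with smaller degree.\<close>
      then have "T (E q) = scale c (E q)"
        using less.prems by (simp add: add_eq_0_iff2)
      then show ?thesis
        using less.hyps[OF \<open>degree q < degree p\<close> \<open>q \<noteq> 0\<close>] E_V[of q] by blast
    qed
  qed
qed

section \<open>Operators defined by weight functions on the group\<close>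

locale group_rep = group G for G :: "('g, 'm) monoid_scheme" (structure) +
  fixes \<pi> :: "('g, 'v::ab_group_add) rep"
  assumes rep: "is_rep G \<pi>"
begin

sublocale vector_space "rep_scale \<pi>"
  using rep by (simp add: is_rep_def)

lemma subspace_rep_space: "subspace (rep_space \<pi>)"
  using rep by (simp add: is_rep_def)

lemma act_closed: "g \<in> carrier G \<Longrightarrow> v \<in> rep_space \<pi> \<Longrightarrow> rep_act \<pi> g v \<in> rep_space \<pi>"
  and act_add: "g \<in> carrier G \<Longrightarrow> v \<in> rep_space \<pi> \<Longrightarrow> w \<in> rep_space \<pi> \<Longrightarrow>
    rep_act \<pi> g (v + w) = rep_act \<pi> g v + rep_act \<pi> g w"
  and act_scale: "g \<in> carrier G \<Longrightarrow> v \<in> rep_space \<pi> \<Longrightarrow>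
    rep_act \<pi> g (rep_scale \<pi> c v) = rep_scale \<pi> c (rep_act \<pi> g v)"
  and act_mult: "g \<in> carrier G \<Longrightarrow> h \<in> carrier G \<Longrightarrow> v \<in> rep_space \<pi> \<Longrightarrow>
    rep_act \<pi> (g \<otimes> h) v = rep_act \<pi> g (rep_act \<pi> h v)"
  using rep by (simp_all add: is_rep_def)

lemma act_sum:
  assumes "g \<in> carrier G" "\<And>x. x \<in> A \<Longrightarrow> f x \<in> rep_space \<pi>"
  shows "rep_act \<pi> g (\<Sum>x\<in>A. f x) = (\<Sum>x\<in>A. rep_act \<pi> g (f x))"
proof -
  have "rep_act \<pi> g 0 = 0"
    using act_scale[OF assms(1) subspace_0[OF subspace_rep_space], of 0] by simp
  then show ?thesis
    using assms
    by (induction A rule: infinite_finite_induct)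
       (simp_all add: act_add subspace_sum[OF subspace_rep_space])
qed

text \<open>The action of the group algebra element with coefficients \<open>c\<close>. The Gauss
  and Jacobi operators are all of this form up to scalars.\<close>

definition rep_sum :: "('g \<Rightarrow> complex) \<Rightarrow> 'v \<Rightarrow> 'v" where
  "rep_sum c v = (\<Sum>g\<in>carrier G. rep_scale \<pi> (c g) (rep_act \<pi> g v))"

lemma rep_sum_closed: "v \<in> rep_space \<pi> \<Longrightarrow> rep_sum c v \<in> rep_space \<pi>"
  unfolding rep_sum_def
  by (intro subspace_sum subspace_scale subspace_rep_space act_closed)

lemma rep_sum_add:
  "v \<in> rep_space \<pi> \<Longrightarrow> w \<in> rep_space \<pi> \<Longrightarrow> rep_sum c (v + w) = rep_sum c v + rep_sum c w"
  by (simp add: rep_sum_def act_add scale_right_distrib sum.distrib)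

lemma rep_sum_scale:
  "v \<in> rep_space \<pi> \<Longrightarrow> rep_sum c (rep_scale \<pi> a v) = rep_scale \<pi> a (rep_sum c v)"
  by (simp add: rep_sum_def act_scale scale_sum_right mult.commute)

lemma act_rep_sum:
  assumes "h \<in> carrier G" "v \<in> rep_space \<pi>"
  shows "rep_act \<pi> h (rep_sum c v) = (\<Sum>g\<in>carrier G. rep_scale \<pi> (c g) (rep_act \<pi> (h \<otimes> g) v))"
  unfolding rep_sum_def
  using assms by (simp add: act_sum act_scale act_mult act_closed subspace_scale[OF subspace_rep_space])

text \<open>A class function is a central element of the group algebra.\<close>

lemma act_rep_sum_commute:
  assumes c: "\<And>g h. g \<in> carrier G \<Longrightarrow> h \<in> carrier G \<Longrightarrow> c (g \<otimes> h) = c (h \<otimes> g)"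
    and h: "h \<in> carrier G" and v: "v \<in> rep_space \<pi>"
  shows "rep_act \<pi> h (rep_sum c v) = rep_sum c (rep_act \<pi> h v)"
proof -
  \<comment> \<open>The shifted weight returns \<open>c g\<close> at \<open>h \<otimes> g\<close> by
    cancellation and at \<open>g \<otimes> h\<close> by the class property, so left and right
    translation of one sum give both sides.\<close>
  let ?f = "\<lambda>g. rep_scale \<pi> (c (inv h \<otimes> g)) (rep_act \<pi> g v)"
  have "rep_act \<pi> h (rep_sum c v) = (\<Sum>g\<in>carrier G. ?f (h \<otimes> g))"
    unfolding act_rep_sum[OF h v]
    by (intro sum.cong) (use h in \<open>simp_all add: m_assoc[symmetric]\<close>)
  also have "\<dots> = (\<Sum>g\<in>carrier G. ?f (g \<otimes> h))"
    by (rule trans[OF sum_left_translate[OF h, of ?f] sum_right_translate[OF h, of ?f, symmetric]])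
  also have "\<dots> = rep_sum c (rep_act \<pi> h v)"
    unfolding rep_sum_def
  proof (intro sum.cong refl)
    fix g assume g: "g \<in> carrier G"
    have "c (inv h \<otimes> (g \<otimes> h)) = c g"
      using g h by (simp add: c[of "inv h"] m_assoc)
    then show "?f (g \<otimes> h) = rep_scale \<pi> (c g) (rep_act \<pi> g (rep_act \<pi> h v))"
      using g h v by (simp add: act_mult)
  qed
  finally show ?thesis .
qed

text \<open>A nonzero vector pins the scalar down, which the definite description in
  \<open>scalar_of\<close> requires.\<close>

lemma scalar_of_eqI:
  assumes "rep_space \<pi> \<noteq> {0}" and T: "\<And>v. v \<in> rep_space \<pi> \<Longrightarrow> T v = rep_scale \<pi> c v"
  shows "scalar_of \<pi> T = c"
proof -
  obtain v where v: "v \<in> rep_space \<pi>" "v \<noteq> 0"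
    using assms(1) subspace_0[OF subspace_rep_space] by blast
  show ?thesis
    unfolding scalar_of_def
  proof (rule the_equality)
    fix d assume "\<forall>v\<in>rep_space \<pi>. T v = rep_scale \<pi> d v"
    then have "rep_scale \<pi> d v = rep_scale \<pi> c v" using T[OF v(1)] v(1) by metis
    then show "d = c" using v(2) by simp
  qed (use T in simp)
qed

text \<open>Extend \<open>v\<close> to a basis of the ambient space, take the coordinate at
  \<open>v\<close> and cut it off outside the representation space.\<close>

lemma exists_dual_nonzero:
  assumes v: "v \<in> rep_space \<pi>" "v \<noteq> 0"
  shows "\<exists>f\<in>dual_space \<pi>. f v \<noteq> 0"
proof -
  let ?B = "extend_basis {v}"
  have v_indep: "independent {v}" using v by simp
  have B: "independent ?B" "span ?B = UNIV" "v \<in> ?B"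
    using independent_extend_basis[OF v_indep] span_extend_basis[OF v_indep]
      extend_basis_superset[OF v_indep] by auto
  define f where "f w = (if w \<in> rep_space \<pi> then representation ?B w v else 0)" for w
  have "f \<in> dual_space \<pi>"
    using B by (auto simp: dual_space_def f_def representation_add representation_scale
        subspace_add[OF subspace_rep_space] subspace_scale[OF subspace_rep_space])
  moreover have "f v = 1" using B v by (simp add: f_def representation_basis)
  ultimately show ?thesis by (intro bexI[of _ f]) simp_all
qed

text \<open>Schur's lemma: the eigenspace of an eigenvalue of \<open>rep_sum c\<close> is nonzero,
  and invariant because the operator commutes with the action, hence it is everything.\<close>

lemma schur_rep_sum:
  assumes irr: "irreducible_rep G \<pi>"
    and c: "\<And>g h. g \<in> carrier G \<Longrightarrow> h \<in> carrier G \<Longrightarrow> c (g \<otimes> h) = c (h \<otimes> g)"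
  shows "\<exists>z. \<forall>v\<in>rep_space \<pi>. rep_sum c v = rep_scale \<pi> z v"
proof -
  obtain B where B: "finite B" "rep_space \<pi> \<subseteq> span B"
    using rep by (auto simp: is_rep_def)
  have "rep_space \<pi> \<noteq> {0}" using irr by (simp add: irreducible_rep_def)
  then have "\<exists>z v. v \<in> rep_space \<pi> \<and> v \<noteq> 0 \<and> rep_sum c v = rep_scale \<pi> z v"
    by (intro exists_eigenvector[where T = "rep_sum c", OF vector_space_axioms subspace_rep_space B])
       (simp_all add: rep_sum_closed rep_sum_add rep_sum_scale)
  then obtain z v where zv: "v \<in> rep_space \<pi>" "v \<noteq> 0" "rep_sum c v = rep_scale \<pi> z v"
    by blast
  define W where "W = {v \<in> rep_space \<pi>. rep_sum c v = rep_scale \<pi> z v}"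
  have "subspace W"
    unfolding W_def
    using rep_sum_scale[OF subspace_0[OF subspace_rep_space], of c 0]
    by (intro subspaceI)
       (auto simp: rep_sum_add rep_sum_scale scale_right_distrib mult.commute
         intro: subspace_0 subspace_add subspace_scale subspace_rep_space)
  moreover have "rep_act \<pi> g w \<in> W" if "g \<in> carrier G" "w \<in> W" for g w
    using that by (auto simp: W_def act_closed act_rep_sum_commute[of c, OF c, symmetric] act_scale)
  moreover have "W \<subseteq> rep_space \<pi>" "W \<noteq> {0}" using zv by (auto simp: W_def)
  ultimately have "W = rep_space \<pi>" using irr unfolding irreducible_rep_def by blast
  then show ?thesis by (auto simp: W_def)
qed

lemma rep_sum_mult:
  "rep_scale \<pi> a (rep_sum c v) = rep_sum (\<lambda>g. a * c g) v"
  by (simp add: rep_sum_def scale_sum_right)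

text \<open>Multiplication in the group algebra is convolution of weights; the substitution
  \<open>h = x \<otimes> g\<close> separates the two factors.\<close>

lemma rep_sum_convolution:
  assumes v: "v \<in> rep_space \<pi>"
  shows "(\<Sum>g\<in>carrier G. rep_scale \<pi> (\<Sum>x\<in>carrier G. a (inv x) * b (x \<otimes> g)) (rep_act \<pi> g v))
       = rep_sum a (rep_sum b v)"
proof -
  have "(\<Sum>g\<in>carrier G. rep_scale \<pi> (\<Sum>x\<in>carrier G. a (inv x) * b (x \<otimes> g)) (rep_act \<pi> g v))
      = (\<Sum>x\<in>carrier G. \<Sum>g\<in>carrier G. rep_scale \<pi> (a (inv x) * b (x \<otimes> g)) (rep_act \<pi> g v))"
    by (subst sum.swap) (simp add: scale_sum_left)
  also have "\<dots> = (\<Sum>x\<in>carrier G. rep_scale \<pi> (a (inv x)) (rep_act \<pi> (inv x) (rep_sum b v)))"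
  proof (intro sum.cong refl)
    fix x assume x: "x \<in> carrier G"
    let ?f = "\<lambda>g. rep_scale \<pi> (a (inv x) * b g) (rep_act \<pi> (inv x \<otimes> g) v)"
    have "(\<Sum>g\<in>carrier G. rep_scale \<pi> (a (inv x) * b (x \<otimes> g)) (rep_act \<pi> g v))
        = (\<Sum>g\<in>carrier G. ?f (x \<otimes> g))"
      using x by (intro sum.cong) (simp_all add: m_assoc[symmetric])
    also have "\<dots> = (\<Sum>g\<in>carrier G. ?f g)"
      by (rule sum_left_translate[OF x])
    also have "\<dots> = rep_scale \<pi> (a (inv x)) (rep_act \<pi> (inv x) (rep_sum b v))"
      using x v by (simp add: act_rep_sum scale_sum_right)
    finally show "(\<Sum>g\<in>carrier G. rep_scale \<pi> (a (inv x) * b (x \<otimes> g)) (rep_act \<pi> g v))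
        = rep_scale \<pi> (a (inv x)) (rep_act \<pi> (inv x) (rep_sum b v))" .
  qed
  also have "\<dots> = rep_sum a (rep_sum b v)"
    unfolding rep_sum_def
    by (rule sum_inverse[of "\<lambda>x. rep_scale \<pi> (a x) (rep_act \<pi> x (\<Sum>g\<in>carrier G. rep_scale \<pi> (b g) (rep_act \<pi> g v)))"])
  finally show ?thesis .
qed

text \<open>The dual action involves the inverse, so inverting the summation variable turns the
  operator into \<open>f \<mapsto> f \<circ> rep_sum c\<close>, the transpose of a scalar
  operator.\<close>

lemma scalar_of_contragredient:
  assumes ne: "rep_space \<pi> \<noteq> {0}"
    and z: "\<And>v. v \<in> rep_space \<pi> \<Longrightarrow> rep_sum c v = rep_scale \<pi> z v"
  shows "scalar_of (contragredient G \<pi>)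
     (\<lambda>f. \<Sum>g\<in>carrier G. rep_scale (contragredient G \<pi>) (c (inv g)) (rep_act (contragredient G \<pi>) g f)) = z"
proof -
  have sum_apply: "(\<Sum>x\<in>A. F x) v = (\<Sum>x\<in>A. F x v)" for F :: "'g \<Rightarrow> 'v \<Rightarrow> complex" and A v
    by (induction A rule: infinite_finite_induct) simp_all
  have dual_sum: "f (\<Sum>x\<in>A. F x) = (\<Sum>x\<in>A. f (F x))"
    if f: "f \<in> dual_space \<pi>" and F: "\<And>x. x \<in> A \<Longrightarrow> F x \<in> rep_space \<pi>" for f F and A :: "'g set"
  proof -
    have "f (rep_scale \<pi> 0 0) = 0 * f 0"
      using f subspace_0[OF subspace_rep_space] unfolding dual_space_def by blast
    then have "f 0 = 0" by simp
    then show ?thesis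
      using F f
      by (induction A rule: infinite_finite_induct)
         (simp_all add: dual_space_def subspace_sum[OF subspace_rep_space])
  qed
  have T: "(\<Sum>g\<in>carrier G. rep_scale (contragredient G \<pi>) (c (inv g)) (rep_act (contragredient G \<pi>) g f))
      = (\<lambda>v. z * f v)" if f: "f \<in> dual_space \<pi>" for f
  proof
    fix v
    show "(\<Sum>g\<in>carrier G. rep_scale (contragredient G \<pi>) (c (inv g))
        (rep_act (contragredient G \<pi>) g f)) v = z * f v"
    proof (cases "v \<in> rep_space \<pi>")
      case False
      then show ?thesis using f by (simp add: sum_apply contragredient_def dual_space_def)
    next
      case True
      have "(\<Sum>g\<in>carrier G. rep_scale (contragredient G \<pi>) (c (inv g))
          (rep_act (contragredient G \<pi>) g f)) v
          = (\<Sum>g\<in>carrier G. c (inv g) * f (rep_act \<pi> (inv g) v))"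
        using True by (simp add: sum_apply contragredient_def)
      also have "\<dots> = (\<Sum>g\<in>carrier G. c g * f (rep_act \<pi> g v))"
        by (rule sum_inverse)
      also have "\<dots> = f (rep_sum c v)"
        unfolding rep_sum_def
        using True f by (subst dual_sum)
          (auto simp: act_closed subspace_scale[OF subspace_rep_space] dual_space_def)
      also have "\<dots> = z * f v" using z[OF True] f True by (simp add: dual_space_def)
      finally show ?thesis .
    qed
  qed
  \<comment> \<open>Uniqueness of the scalar on the dual needs a functional that is nonzero
    somewhere.\<close>
  obtain v where "v \<in> rep_space \<pi>" "v \<noteq> 0"
    using ne subspace_0[OF subspace_rep_space] by blast
  then obtain f where f: "f \<in> dual_space \<pi>" "f v \<noteq> 0" using exists_dual_nonzero by blast
  show ?thesis
    unfolding scalar_of_def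
  proof (rule the_equality)
    fix d
    assume "\<forall>f\<in>rep_space (contragredient G \<pi>). (\<Sum>g\<in>carrier G. rep_scale (contragredient G \<pi>) (c (inv g))
      (rep_act (contragredient G \<pi>) g f)) = rep_scale (contragredient G \<pi>) d f"
    then have "(\<lambda>v. z * f v) = (\<lambda>v. d * f v)"
      using f(1) T[OF f(1)] by (simp add: contragredient_def)
    then have "z * f v = d * f v" by (rule fun_cong)
    then show "d = z" using f(2) by simp
  next
    show "\<forall>f\<in>rep_space (contragredient G \<pi>). (\<Sum>g\<in>carrier G. rep_scale (contragredient G \<pi>) (c (inv g))
      (rep_act (contragredient G \<pi>) g f)) = rep_scale (contragredient G \<pi>) z f"
      using T by (simp add: contragredient_def)
  qed
qed

end

section \<open>The Jacobi sum\<close>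

lemma contragredient_scale_scale:
  "rep_scale (contragredient G \<pi>) a (rep_scale (contragredient G \<pi>) b f)
   = rep_scale (contragredient G \<pi>) (a * b) f"
  by (simp add: contragredient_def mult.assoc)

lemma contragredient_scale_sum:
  "rep_scale (contragredient G \<pi>) a (\<Sum>x\<in>A. F x) = (\<Sum>x\<in>A. rep_scale (contragredient G \<pi>) a (F x))"
  by (induction A rule: infinite_finite_induct)
     (auto simp: contragredient_def fun_eq_iff distrib_left)

lemma kondo_gauss_trivial_rep:
  fixes \<iota> :: "'f::{field,finite} \<Rightarrow> 'e::{field,finite}"
  shows "kondo_gauss \<iota> \<psi> k trivial_rep (\<lambda>_. 1)
       = norm_factor \<iota> (k\<^sup>2) * (\<Sum>g\<in>carrier (GL k). ext_character \<iota> \<psi> (mat_trace g))"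
proof -
  interpret group "GL k :: 'e mat monoid" by (rule group_GL)
  let ?c = "norm_factor \<iota> (k\<^sup>2) * (\<Sum>g\<in>carrier (GL k). ext_character \<iota> \<psi> (mat_trace g))"
  have "kondo_gauss \<iota> \<psi> k trivial_rep (\<lambda>_. 1) = (THE d. \<forall>v. ?c * v = d * v)"
    using sum_inverse[of "\<lambda>g. ext_character \<iota> \<psi> (mat_trace g)"]
    by (simp add: kondo_gauss_def scalar_of_def trivial_rep_def sum_distrib_right[symmetric] mult.assoc)
  also have "\<dots> = ?c"
    by (rule the_equality) (auto dest: spec[of _ 1])
  finally show ?thesis .
qed

lemma abelian_gauss_inverse:
  "abelian_gauss \<iota> \<psi> (\<lambda>x. inverse (\<chi> x)) = - norm_factor \<iota> 1 * gauss_sum (ext_character \<iota> \<psi>) \<chi>"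
  by (simp add: abelian_gauss_def gauss_sum_def)

lemma mult_character_minus_one:
  assumes "mult_character \<chi>"
  shows "\<chi> (- 1) * \<chi> (- 1) = 1"
proof -
  have "\<chi> (- 1 * - 1) = \<chi> (- 1) * \<chi> (- 1)"
    using assms[unfolded mult_character_def, THEN conjunct1, rule_format, of "- 1" "- 1"] by simp
  then show ?thesis using mult_character_one[OF assms] by simp
qed

text \<open>For trivial \<open>\<chi>\<close> the kernel is a Fourier transform by definition and
  only constants are compared. For nontrivial \<open>\<chi>\<close> both sides vanish when
  \<open>1 + g\<close> is singular; otherwise the twist produces \<open>\<chi> (det (1 + g))\<close>
  times a constant that equals 1.\<close>

lemma jacobi_kernel_fourier:
  fixes \<iota> :: "'f::{field,finite} \<Rightarrow> 'e::{field,finite}"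
  assumes \<iota>: "field_hom \<iota>" and \<chi>: "mult_character \<chi>"
    and \<phi>: "add_character (ext_character \<iota> \<psi>)" "\<exists>x. ext_character \<iota> \<psi> x \<noteq> 1"
    and g: "g \<in> carrier_mat k k"
  shows "jacobi_kernel \<iota> \<psi> k \<chi> g =
    norm_factor \<iota> (k\<^sup>2) * \<chi> (- 1) ^ k * (- abelian_gauss \<iota> \<psi> (\<lambda>x. inverse (\<chi> x))) ^ k *
    (\<Sum>x\<in>carrier (GL k). inverse (\<chi> (det x)) * ext_character \<iota> \<psi> (mat_trace (x * (1\<^sub>m k + g))))"
proof -
  define \<phi> where "\<phi> = ext_character \<iota> \<psi>"
  define Q where "Q = complex_of_nat CARD('e)"
  define r where "r = inverse (complex_of_real (sqrt (real CARD('e))))"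
  have nf: "norm_factor \<iota> m = r ^ m" for m
    by (simp add: norm_factor_eq[OF \<iota>] r_def)
  have "r * r = inverse (complex_of_real (sqrt (real CARD('e)) * sqrt (real CARD('e))))"
    by (simp only: r_def of_real_mult inverse_mult_distrib)
  also have "\<dots> = inverse Q" by (simp add: Q_def)
  finally have rrQ: "r * r * Q = 1" by (simp add: Q_def)
  \<comment> \<open>Since \<open>r * r * Q = 1\<close>, the power of \<open>Q\<close> cancels
    \<open>k * (k - 1)\<close> of the \<open>k\<^sup>2\<close> factors \<open>r\<close>.\<close>
  have norm: "r ^ k\<^sup>2 * Q ^ (k * (k - 1) div 2) = r ^ k"
  proof -
    have "even (k * (k - 1))" by (cases k) auto
    then obtain m where m: "k * (k - 1) = 2 * m" by (rule evenE)
    have "k\<^sup>2 = k + 2 * m" using m by (cases k) (auto simp: power2_eq_square)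
    then have "r ^ k\<^sup>2 * Q ^ (k * (k - 1) div 2) = r ^ k * (r * r * Q) ^ m"
      using m by (simp add: power_add power_mult power_mult_distrib power2_eq_square)
    then show ?thesis by (simp add: rrQ)
  qed
  have A: "1\<^sub>m k + g \<in> carrier_mat k k" using g by simp
  show ?thesis
  proof (cases "trivial_character \<chi>")
    case True
    then have \<chi>_one: "\<chi> x = 1" if "x \<noteq> 0" for x using that by (simp add: trivial_character_def)
    have "(\<Sum>x\<in>carrier (GL k). \<phi> (mat_trace x)) = Q ^ (k * (k - 1) div 2) * (- 1) ^ k"
      using GL_gauss_sum[OF \<phi>, of "\<lambda>_. 1" k] gauss_sum_trivial[OF \<phi>, of "\<lambda>_. 1"]
      by (simp add: mult_character_def trivial_character_def \<phi>_def Q_def)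
    \<comment> \<open>The field Gauss sum is \<open>-1\<close> here, so the kernel's constant and
      the abelian factor are both \<open>(- r) ^ k\<close>.\<close>
    then have "kondo_gauss \<iota> \<psi> k trivial_rep (\<lambda>_. 1) = (- r) ^ k"
      using norm by (simp add: kondo_gauss_trivial_rep nf \<phi>_def power_minus[of r] mult.commute)
    moreover have "- abelian_gauss \<iota> \<psi> (\<lambda>x. inverse (\<chi> x)) = - r"
      using gauss_sum_trivial[OF \<phi> True] by (simp add: abelian_gauss_inverse nf)
    moreover have "(\<Sum>x\<in>carrier (GL k). inverse (\<chi> (det x)) * \<phi> (mat_trace (x * (1\<^sub>m k + g))))
        = (\<Sum>x\<in>carrier (GL k). \<phi> (mat_trace (x * (1\<^sub>m k + g))))"
      by (intro sum.cong) (auto simp: carrier_GL \<chi>_one)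
    ultimately show ?thesis
      using True \<chi>_one[of "- 1"] by (simp add: jacobi_kernel_def \<phi>_def nf)
  next
    case False
    let ?C = "\<Sum>x\<in>carrier (GL k). inverse (\<chi> (det x)) * \<phi> (mat_trace x)"
    let ?K = "r ^ k\<^sup>2 * \<chi> (- 1) ^ k * (r * gauss_sum \<phi> \<chi>) ^ k"
    have "?C = Q ^ (k * (k - 1) div 2) * gauss_sum \<phi> (\<lambda>x. inverse (\<chi> x)) ^ k"
      using GL_gauss_sum[OF \<phi> mult_character_inverse[OF \<chi>], of k] by (simp add: \<phi>_def Q_def)
    then have "?K * ?C = (r ^ k\<^sup>2 * Q ^ (k * (k - 1) div 2)) *
        (\<chi> (- 1) * r * (gauss_sum \<phi> \<chi> * gauss_sum \<phi> (\<lambda>x. inverse (\<chi> x)))) ^ k"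
      by (simp add: power_mult_distrib mult_ac)
    \<comment> \<open>Of \<open>r ^ k\<^sup>2\<close> only \<open>r ^ k\<close> survives; it
      supplies the second \<open>r\<close> in each of the \<open>k\<close> factors, and the product
      of the two Gauss sums supplies \<open>Q\<close> and the second sign.\<close>
    also have "\<dots> = (\<chi> (- 1) * \<chi> (- 1) * (r * r * Q)) ^ k"
      unfolding norm using gauss_sum_inverse[OF \<phi> \<chi> False]
      by (simp add: power_mult_distrib mult_ac \<phi>_def Q_def)
    also have "\<dots> = 1" by (simp only: rrQ mult_character_minus_one[OF \<chi>]) simp
    finally have KC: "?K * ?C = 1" .
    have K: "- abelian_gauss \<iota> \<psi> (\<lambda>x. inverse (\<chi> x)) = r * gauss_sum \<phi> \<chi>"
      by (simp add: abelian_gauss_inverse nf \<phi>_def)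
    show ?thesis
    proof (cases "det (1\<^sub>m k + g) = 0")
      case True
      then show ?thesis
        using False GL_gauss_sum_twist_singular[OF \<chi> False A True]
        by (simp add: jacobi_kernel_def)
    next
      case det: False
      then have "1\<^sub>m k + g \<in> carrier (GL k)" using A by (simp add: carrier_GL)
      from GL_gauss_sum_twist[OF \<chi> this, of \<phi>]
      have "?K * (\<Sum>x\<in>carrier (GL k). inverse (\<chi> (det x)) * \<phi> (mat_trace (x * (1\<^sub>m k + g))))
          = \<chi> (det (1\<^sub>m k + g)) * (?K * ?C)" by (simp only: mult_ac)
      then show ?thesis
        using False det unfolding K nf KC by (simp add: jacobi_kernel_def \<phi>_def)
    qed
  qed
qed

theorem theorem3p3:
  fixes \<iota> :: "'f::{field,finite} \<Rightarrow> 'e::{field,finite}"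
    and \<psi> :: "'f \<Rightarrow> complex"
    and \<chi> :: "'e \<Rightarrow> complex"
    and \<tau> :: "('e mat, 'v::ab_group_add) rep"
    and k :: nat
  assumes "odd CARD('f)"
    and "field_hom \<iota>"
    and "ext_degree \<iota> \<in> {1, 2}"
    and "k \<ge> 1"
    and "irreducible_rep (GL k) \<tau>"
    and "mult_character \<chi>"
    and "add_character \<psi>"
    and "\<exists>x. \<psi> x \<noteq> 1"
  shows "jacobi_dbl \<iota> \<psi> k \<tau> \<chi> =
           \<chi> (- 1) ^ k *
           (- abelian_gauss \<iota> \<psi> (\<lambda>x. inverse (\<chi> x))) ^ k *
           kondo_gauss \<iota> \<psi> k (contragredient (GL k) \<tau>) (\<lambda>_. 1) *
           kondo_gauss \<iota> \<psi> k \<tau> \<chi>"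
proof -
  define \<phi> where "\<phi> = ext_character \<iota> \<psi>"
  have \<phi>: "add_character \<phi>" "\<exists>x. \<phi> x \<noteq> 1"
    using ext_character[OF assms(2,7)] ext_character_nontrivial[OF assms(2,1,3)] assms(8)
    by (auto simp: \<phi>_def)
  interpret group "GL k :: 'e mat monoid" by (rule group_GL)
  interpret group_rep "GL k :: 'e mat monoid" \<tau>
    by unfold_locales (use assms(5) in \<open>simp add: irreducible_rep_def\<close>)
  have ne: "rep_space \<tau> \<noteq> {0}" using assms(5) by (simp add: irreducible_rep_def)
  define nf where "nf = norm_factor \<iota> (k\<^sup>2)"
  have nf: "nf \<noteq> 0" by (simp add: nf_def norm_factor_eq[OF assms(2)])
  define K where "K = \<chi> (- 1) ^ k * (- abelian_gauss \<iota> \<psi> (\<lambda>x. inverse (\<chi> x))) ^ k"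
  \<comment> \<open>\<open>a\<close> is the weight in the Gauss sum of \<open>\<tau>\<close> twisted
    by \<open>\<chi>\<close>; \<open>b\<close> at the inverse of \<open>g\<close> is the weight in
    that of the contragredient.\<close>
  define a where "a g = \<chi> (det g) * \<phi> (mat_trace (inv\<^bsub>GL k\<^esub> g))" for g
  define b where "b g = \<phi> (mat_trace g)" for g
  have GL_carrier: "g \<in> carrier_mat k k" if "g \<in> carrier (GL k)" for g :: "'e mat"
    using that by (simp add: carrier_GL)
  have trace_commute: "mat_trace (g * h) = mat_trace (h * g)"
    if "g \<in> carrier (GL k)" "h \<in> carrier (GL k)" for g h :: "'e mat"
    using mat_trace_mult_commute that GL_carrier by blast
  have b_class: "b (g \<otimes>\<^bsub>GL k\<^esub> h) = b (h \<otimes>\<^bsub>GL k\<^esub> g)"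
    if "g \<in> carrier (GL k)" "h \<in> carrier (GL k)" for g h
    using trace_commute[OF that] by (simp add: b_def)
  have a_class: "a (g \<otimes>\<^bsub>GL k\<^esub> h) = a (h \<otimes>\<^bsub>GL k\<^esub> g)"
    if "g \<in> carrier (GL k)" "h \<in> carrier (GL k)" for g h
  proof -
    have "det (g * h) = det (h * g)"
      using that by (simp add: det_mult[OF GL_carrier GL_carrier])
    moreover have "inv\<^bsub>GL k\<^esub> (g * h) = inv\<^bsub>GL k\<^esub> h * inv\<^bsub>GL k\<^esub> g"
      "inv\<^bsub>GL k\<^esub> (h * g) = inv\<^bsub>GL k\<^esub> g * inv\<^bsub>GL k\<^esub> h"
      using inv_mult_group[OF that] inv_mult_group[OF that(2,1)] by simp_all
    ultimately show ?thesis
      using trace_commute[of "inv\<^bsub>GL k\<^esub> g" "inv\<^bsub>GL k\<^esub> h"] that by (simp add: a_def)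
  qed
  obtain za where za: "\<And>v. v \<in> rep_space \<tau> \<Longrightarrow> rep_sum a v = rep_scale \<tau> za v"
    using schur_rep_sum[of a, OF assms(5) a_class] by blast
  obtain zb where zb: "\<And>v. v \<in> rep_space \<tau> \<Longrightarrow> rep_sum b v = rep_scale \<tau> zb v"
    using schur_rep_sum[of b, OF assms(5) b_class] by blast
  have kondo_\<tau>: "kondo_gauss \<iota> \<psi> k \<tau> \<chi> = nf * za"
    unfolding kondo_gauss_def
  proof (rule scalar_of_eqI[OF ne])
    fix v assume v: "v \<in> rep_space \<tau>"
    show "rep_scale \<tau> (norm_factor \<iota> (k\<^sup>2)) (\<Sum>g\<in>carrier (GL k). rep_scale \<tau>
        (\<chi> (det g) * ext_character \<iota> \<psi> (mat_trace (inv\<^bsub>GL k\<^esub> g))) (rep_act \<tau> g v))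
      = rep_scale \<tau> (nf * za) v"
      using za[OF v] by (simp add: rep_sum_def a_def \<phi>_def nf_def)
  qed
  have kondo_dual: "kondo_gauss \<iota> \<psi> k (contragredient (GL k) \<tau>) (\<lambda>_. 1) = nf * zb"
  proof -
    \<comment> \<open>The normalization is moved into the weight, so that the Gauss operator becomes
      one weighted sum to which the transpose argument applies.\<close>
    have "rep_sum (\<lambda>g. nf * b g) v = rep_scale \<tau> (nf * zb) v" if "v \<in> rep_space \<tau>" for v
      using zb[OF that] by (simp flip: rep_sum_mult)
    from scalar_of_contragredient[OF ne this] show ?thesis
      by (simp add: kondo_gauss_def b_def \<phi>_def nf_def contragredient_scale_sum
          flip: contragredient_scale_scale)
  qed
  \<comment> \<open>One \<open>nf\<close> normalizes the Jacobi sum and the other comes from the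
    Fourier expansion of the kernel; each Gauss sum takes one.\<close>
  have "jacobi_dbl \<iota> \<psi> k \<tau> \<chi> = K * (nf * zb) * (nf * za)"
    unfolding jacobi_dbl_def
  proof (rule scalar_of_eqI[OF ne])
    fix v assume v: "v \<in> rep_space \<tau>"
    have "jacobi_kernel \<iota> \<psi> k \<chi> g
        = (\<Sum>x\<in>carrier (GL k). (nf * K * a (inv\<^bsub>GL k\<^esub> x)) * b (x \<otimes>\<^bsub>GL k\<^esub> g))"
      if g: "g \<in> carrier (GL k)" for g
    proof -
      \<comment> \<open>The additive character splits over \<open>x + x * g\<close>. The part in
        \<open>x\<close> alone is \<open>a\<close> at the inverse of \<open>x\<close>, which gives
        the convolution form.\<close>
      have "inverse (\<chi> (det x)) * \<phi> (mat_trace (x * (1\<^sub>m k + g))) = a (inv\<^bsub>GL k\<^esub> x) * b (x * g)"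
        if x: "x \<in> carrier (GL k)" for x
      proof -
        note c = GL_carrier[OF x] GL_carrier[OF g]
        have "mat_trace (x * (1\<^sub>m k + g)) = mat_trace x + mat_trace (x * g)"
          using c mult_add_distrib_mat[of x k k "1\<^sub>m k" k g] mat_trace_add[of x k "x * g"] by simp
        moreover have "\<chi> (det (inv\<^bsub>GL k\<^esub> x)) = inverse (\<chi> (det x))"
        proof -
          have ix: "inv\<^bsub>GL k\<^esub> x \<in> carrier (GL k)" using x by simp
          have "det (inv\<^bsub>GL k\<^esub> x) * det x = 1"
            using l_inv[OF x] det_mult[OF GL_carrier[OF ix] c(1)] by simp
          then have "\<chi> (det (inv\<^bsub>GL k\<^esub> x)) * \<chi> (det x) = 1"
            using assms(6)[unfolded mult_character_def, THEN conjunct1, rule_format,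
                of "det (inv\<^bsub>GL k\<^esub> x)" "det x"] mult_character_one[OF assms(6)] x ix
            by (auto simp: carrier_GL)
          then have "\<chi> (det x) * \<chi> (det (inv\<^bsub>GL k\<^esub> x)) = 1" by (simp only: mult.commute)
          then show ?thesis by (rule inverse_unique[symmetric])
        qed
        ultimately show ?thesis
          using \<phi>(1) x by (simp add: a_def b_def add_character_def)
      qed
      then show ?thesis
        using jacobi_kernel_fourier[OF assms(2,6) \<phi>[unfolded \<phi>_def] GL_carrier[OF g]]
        by (simp add: nf_def K_def \<phi>_def sum_distrib_left mult.assoc)
    qed
    then have "(\<Sum>g\<in>carrier (GL k). rep_scale \<tau> (jacobi_kernel \<iota> \<psi> k \<chi> g) (rep_act \<tau> g v))
        = rep_sum (\<lambda>x. nf * K * a x) (rep_sum b v)"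
      using rep_sum_convolution[OF v, of "\<lambda>x. nf * K * a x" b] by (simp cong: sum.cong)
    also have "\<dots> = rep_scale \<tau> (nf * K * za * zb) v"
      using v zb[OF v] za[OF v] subspace_scale[OF subspace_rep_space v]
      by (simp add: rep_sum_mult[symmetric] rep_sum_scale)
    finally show "rep_scale \<tau> (norm_factor \<iota> (k\<^sup>2)) (\<Sum>g\<in>carrier (GL k).
        rep_scale \<tau> (jacobi_kernel \<iota> \<psi> k \<chi> g) (rep_act \<tau> g v)) = rep_scale \<tau> (K * (nf * zb) * (nf * za)) v"
      by (simp add: nf_def mult_ac)
  qed
  then show ?thesis by (simp only: kondo_\<tau> kondo_dual K_def)
qed

end
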